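(* For each integer $s\ge 2$ let $n=s^{5s+1}$ and let $L^{(s)}$ be the balanced necklace with $2n$ beads ($n$ red, $n$ blue) given by the Construction described in the context with parameter $\lambda=1-\frac{1}{\sqrt2}$. Then, as $s\to\infty$, the maximum size (number of matched pairs) of a proper matching of $L^{(s)}$ is at most $(2-\sqrt2)\,n+o(n)$, both in the heterogeneous model and in the homogeneous model. Consequently $\mu\le 2-\sqrt2$ and $\mu^{\mathrm{hom}}\le 2-\sqrt2$. Moreover, $\mathrm{mono}(L^{(s)})=o(n)$ as $s\to\infty$.
   Context: A necklace is a cyclic sequence of beads, each colored red or blue; it is balanced if it has $N=2n$ beads, $n$ red and $n$ blue. A matching is a set of mutually disjoint pairs (edges) of beads; its size is its number of edges. In the heterogeneous model each pair consists of one red and one blue bead; in the homogeneous model each pair consists of two beads of the same color. A matching is cross-free if for any two of its edges $ab$ and $cd$, one of the two arcs between $a$ and $b$ is disjoint from $\{c,d\}$ while the other arc contains $\{c,d\}$. A secant partitions the necklace into two contiguous arcs $A_1,A_2$; a matching is secant-respecting (for that secant) if every edge has one end in $A_1$ and the other in $A_2$. A matching is proper if it is cross-free and secant-respecting for some secant. For even $N$, let $\mathcal N(N)$ be the set of balanced necklaces with $N$ beads. For the heterogeneous model let $\mu(N)=\min_{L\in\mathcal N(N)}\max_M 2|M|$, where $M$ ranges over the proper matchings of $L$, and let $\mu=\limsup_{N\to\infty}\mu(N)/N$ (over even $N$). Define $\mu^{\mathrm{hom}}(N)$ and $\mu^{\mathrm{hom}}$ in the same way for the homogeneous model. For a necklace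 $L$, $\mathrm{mono}(L)$ is the number of maximal monochromatic arcs of $L$ (i.e. the number of color changes). Construction. Let $s\ge2$ be an integer, $n=s^{5s+1}$, and $0<\lambda\le\frac12$. The necklace consists of $s$ consecutive large arcs $L_1,\dots,L_s$ (in clockwise order), each with $s^{5s}$ blue and $s^{5s}$ red beads. First, $L_i$ is divided into $2s^{2s-i}$ consecutive arcs $\ell_{i,1},\dots,\ell_{i,2s^{2s-i}}$, each of $s^{3s+i}$ beads, colored alternately entirely red and entirely blue ($s^{2s-i}$ red and $s^{2s-i}$ blue arcs). Next, each $\ell_{i,j}$ is divided into $s^{s+2i}$ consecutive tiny intervals of $s^{2s-i}$ beads, and in each tiny interval the color of the last (i.e. at the clockwise end) $\lfloor\lambda s^{2s-i}\rfloor$ beads is switched to the other color. *)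

theory Defs
  imports Complex_Main "HOL-Library.Landau_Symbols" "HOL-Library.Extended_Real"
    "HOL-Library.Liminf_Limsup"
begin

datatype color = Red | Blue

fun switch :: "color \<Rightarrow> color" where
  "switch Red = Blue"
| "switch Blue = Red"

text \<open>A necklace with \<open>N\<close> beads is a list of length \<open>N\<close>, read cyclically in clockwise order;
  beads are the positions \<open>0, \<dots>, N - 1\<close>. The notions concerning
  matchings, secants and arcs are invariant under rotation of the list.\<close>

type_synonym necklace = "color list"

definition balanced_necklaces :: "nat \<Rightarrow> necklace set" where
  "balanced_necklaces N = {L. length L = N \<and> 2 * count_list L Red = N \<and> 2 * count_list L Blue = N}"

definition is_arc :: "nat \<Rightarrow> nat set \<Rightarrow> bool" where
  "is_arc N A \<longleftrightarrow> (\<exists>p m. m \<le> N \<and> A = (\<lambda>k. (p + k) mod N) ` {..<m})"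

text \<open>The beads strictly between \<open>a\<close> and \<open>b\<close>, going clockwise from \<open>a\<close> to \<open>b\<close>. The two arcs
  between distinct beads \<open>a\<close> and \<open>b\<close> are \<open>between N a b\<close> and \<open>between N b a\<close>.\<close>

definition between :: "nat \<Rightarrow> nat \<Rightarrow> nat \<Rightarrow> nat set" where
  "between N a b = (if a < b then {a<..<b} else {a<..<N} \<union> {..<b})"

text \<open>The relation \<open>R\<close> tells which pairs of colors may be matched: inequality is the
  heterogeneous model and equality is the homogeneous model.\<close>

definition het :: "color \<Rightarrow> color \<Rightarrow> bool" where
  "het c d \<longleftrightarrow> c \<noteq> d"

definition homog :: "color \<Rightarrow> color \<Rightarrow> bool" where
  "homog c d \<longleftrightarrow> c = d"

definition matching :: "(color \<Rightarrow> color \<Rightarrow> bool) \<Rightarrow> necklace \<Rightarrow> nat set set \<Rightarrow> bool" where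
  "matching R L M \<longleftrightarrow>
     (\<forall>e\<in>M. \<exists>a b. e = {a, b} \<and> a \<noteq> b \<and> a < length L \<and> b < length L \<and> R (L ! a) (L ! b)) \<and>
     pairwise disjnt M"

definition cross_free :: "nat \<Rightarrow> nat set set \<Rightarrow> bool" where
  "cross_free N M \<longleftrightarrow>
     (\<forall>a b c d. {a, b} \<in> M \<longrightarrow> {c, d} \<in> M \<longrightarrow> {a, b} \<noteq> {c, d} \<longrightarrow>
        disjnt (between N a b) {c, d} \<and> {c, d} \<subseteq> between N b a \<or>
        disjnt (between N b a) {c, d} \<and> {c, d} \<subseteq> between N a b)"

text \<open>A secant is given by its two arcs. An empty arc is not excluded: such a secant is
  respected by the empty matching only.\<close>

definition secant :: "nat \<Rightarrow> nat set \<Rightarrow> nat set \<Rightarrow> bool" where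
  "secant N A\<^sub>1 A\<^sub>2 \<longleftrightarrow>
     is_arc N A\<^sub>1 \<and> is_arc N A\<^sub>2 \<and> A\<^sub>1 \<union> A\<^sub>2 = {..<N} \<and> disjnt A\<^sub>1 A\<^sub>2"

definition secant_respecting :: "nat set \<Rightarrow> nat set \<Rightarrow> nat set set \<Rightarrow> bool" where
  "secant_respecting A\<^sub>1 A\<^sub>2 M \<longleftrightarrow> (\<forall>e\<in>M. \<exists>a\<in>A\<^sub>1. \<exists>b\<in>A\<^sub>2. e = {a, b})"

definition proper_matchings :: "(color \<Rightarrow> color \<Rightarrow> bool) \<Rightarrow> necklace \<Rightarrow> nat set set set" where
  "proper_matchings R L = {M. matching R L M \<and> cross_free (length L) M \<and>
     (\<exists>A\<^sub>1 A\<^sub>2. secant (length L) A\<^sub>1 A\<^sub>2 \<and> secant_respecting A\<^sub>1 A\<^sub>2 M)}"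

definition max_proper_size :: "(color \<Rightarrow> color \<Rightarrow> bool) \<Rightarrow> necklace \<Rightarrow> nat" where
  "max_proper_size R L = (MAX M\<in>proper_matchings R L. card M)"

definition mu_at :: "(color \<Rightarrow> color \<Rightarrow> bool) \<Rightarrow> nat \<Rightarrow> nat" where
  "mu_at R N = (MIN L\<in>balanced_necklaces N. MAX M\<in>proper_matchings R L. 2 * card M)"

text \<open>The upper limit over even \<open>N = 2 * k\<close>.\<close>

definition mu :: "(color \<Rightarrow> color \<Rightarrow> bool) \<Rightarrow> ereal" where
  "mu R = limsup (\<lambda>k. ereal (real (mu_at R (2 * k)) / real (2 * k)))"

definition mono_arc :: "necklace \<Rightarrow> nat set \<Rightarrow> bool" where
  "mono_arc L A \<longleftrightarrow> is_arc (length L) A \<and> A \<noteq> {} \<and> (\<exists>c. \<forall>x\<in>A. L ! x = c)"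

definition mono_count :: "necklace \<Rightarrow> nat" where
  "mono_count L = card {A. mono_arc L A \<and> (\<forall>B. mono_arc L B \<longrightarrow> A \<subseteq> B \<longrightarrow> A = B)}"

text \<open>In the construction, \<open>tiny_interval \<lambda> s i c\<close> is a tiny interval inside an arc of
  original color \<open>c\<close>, \<open>small_arc \<lambda> s i j\<close> is \<open>\<ell>\<^sub>i\<^sub>,\<^sub>j\<close> (red for odd \<open>j\<close>, so that each large arc
  starts with red), and \<open>large_arc \<lambda> s i\<close> is \<open>L\<^sub>i\<close>; here \<open>1 \<le> i \<le> s\<close> and
  \<open>1 \<le> j \<le> 2 * s ^ (2 * s - i)\<close>.\<close>

definition tiny_interval :: "real \<Rightarrow> nat \<Rightarrow> nat \<Rightarrow> color \<Rightarrow> color list" where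
  "tiny_interval lam s i c =
     (let w = s ^ (2 * s - i); f = nat \<lfloor>lam * real w\<rfloor>
      in replicate (w - f) c @ replicate f (switch c))"

definition small_arc :: "real \<Rightarrow> nat \<Rightarrow> nat \<Rightarrow> nat \<Rightarrow> color list" where
  "small_arc lam s i j =
     concat (replicate (s ^ (s + 2 * i)) (tiny_interval lam s i (if odd j then Red else Blue)))"

definition large_arc :: "real \<Rightarrow> nat \<Rightarrow> nat \<Rightarrow> color list" where
  "large_arc lam s i = concat (map (small_arc lam s i) [1..<2 * s ^ (2 * s - i) + 1])"

definition construction :: "real \<Rightarrow> nat \<Rightarrow> necklace" where
  "construction lam s = concat (map (large_arc lam s) [1..<s + 1])"

end

theory Submission
  imports Defs
begin

text \<open>A proper matching folds the necklace along its secant, so its edges \<open>(a, b)\<close> form a sequence with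
  \<open>a\<close> increasing and \<open>b\<close> decreasing. Such a sequence can be cut at block boundaries. Apart from at most
  two large arcs met by the secant, only beads of different large arcs \<open>L\<^sub>i\<close>, \<open>L\<^sub>j\<close> with \<open>i < j\<close> are
  matched. There a small arc of \<open>L\<^sub>j\<close> is so long that the part of \<open>L\<^sub>i\<close> folded onto it is half red and half
  blue, while its tiny intervals are so short that a monochromatic run of \<open>L\<^sub>i\<close> sees the two colors in
  the proportion \<open>1 - \<lambda>\<close> to \<open>\<lambda>\<close>. Hence if \<open>u\<close> and \<open>v\<close> edges use the majority and the minority color of the
  small arc, \<open>x\<close> beads of \<open>L\<^sub>i\<close> and \<open>y\<close> beads of \<open>L\<^sub>j\<close> satisfy, up to small errors, \<open>2 u \<le> x\<close> and
  \<open>u / (1 - \<lambda>) + v / \<lambda> \<le> y\<close>, and for \<open>\<lambda> = 1 - 1 / sqrt 2\<close> this gives \<open>u + v \<le> \<lambda> (x + y)\<close>.\<close>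

subsection \<open>Cutting nested sets of edges\<close>

text \<open>This one condition encodes both disjointness and cross-freeness of a folded matching:
  edges differ in both coordinates, and the order reverses from one side to the other.\<close>

definition nested :: "(nat \<times> nat) set \<Rightarrow> bool" where
  "nested E \<longleftrightarrow> (\<forall>a b c d. (a, b) \<in> E \<longrightarrow> (c, d) \<in> E \<longrightarrow> (a, b) \<noteq> (c, d) \<longrightarrow>
     a < c \<and> d < b \<or> c < a \<and> b < d)"

definition edges_in :: "(nat \<times> nat) set \<Rightarrow> nat \<Rightarrow> nat \<Rightarrow> nat \<Rightarrow> nat \<Rightarrow> real" where
  "edges_in E a a' b b' = real (card (E \<inter> {a..<a'} \<times> {b..<b'}))"

lemma nested_subset: "nested E \<Longrightarrow> F \<subseteq> E \<Longrightarrow> nested F"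
  unfolding nested_def by blast

lemma nested_converse: "nested E \<Longrightarrow> nested (E\<inverse>)"
  unfolding nested_def by blast

lemma nested_inj_fst: "nested E \<Longrightarrow> inj_on fst E"
  unfolding nested_def inj_on_def by force

lemma nested_inj_snd: "nested E \<Longrightarrow> inj_on snd E"
  unfolding nested_def inj_on_def by force

lemma edges_in_converse: "edges_in (E\<inverse>) a a' b b' = edges_in E b b' a a'"
proof -
  have "E\<inverse> \<inter> {a..<a'} \<times> {b..<b'} = prod.swap ` (E \<inter> {b..<b'} \<times> {a..<a'})"
    by force
  then show ?thesis
    by (simp add: edges_in_def card_image)
qed

lemma edges_in_le_fst:
  assumes "nested E" "finite X" "\<And>x y. (x, y) \<in> E \<Longrightarrow> x \<in> {a..<a'} \<Longrightarrow> y \<in> {b..<b'} \<Longrightarrow> x \<in> X"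
  shows "edges_in E a a' b b' \<le> card X"
proof -
  let ?F = "E \<inter> {a..<a'} \<times> {b..<b'}"
  have "inj_on fst ?F"
    using nested_inj_fst[OF assms(1)] by (rule inj_on_subset) auto
  moreover have "fst ` ?F \<subseteq> X"
    using assms(3) by auto
  ultimately show ?thesis
    unfolding edges_in_def using card_inj_on_le[of fst ?F X] assms(2) by simp
qed

lemma edges_in_le_snd:
  assumes "nested E" "finite Y" "\<And>x y. (x, y) \<in> E \<Longrightarrow> x \<in> {a..<a'} \<Longrightarrow> y \<in> {b..<b'} \<Longrightarrow> y \<in> Y"
  shows "edges_in E a a' b b' \<le> card Y"
  using edges_in_le_fst[OF nested_converse[OF assms(1)] assms(2), of b b' a a'] assms(3)
  by (simp add: edges_in_converse)

text \<open>Cut the first side at \<open>c\<close> and let \<open>d\<close> be the least partner of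
  a bead before \<open>c\<close>. Partners decrease, so edges starting at \<open>c\<close> or later
  end below \<open>d\<close>.\<close>

lemma nested_split:
  assumes "nested E" "b \<le> b'"
  obtains d where "b \<le> d" "d \<le> b'"
    "edges_in E a a' b b' \<le> edges_in E a c d b' + edges_in E c a' b d"
proof -
  define F where "F = E \<inter> {a..<c} \<times> {b..<b'}"
  \<comment> \<open>The default \<open>b'\<close> serves the case of no edge starting before
    \<open>c\<close>; the left rectangle is then empty.\<close>
  define d where "d = Min (insert b' (snd ` F))"
  have fin: "finite (snd ` F)"
    by (rule finite_subset[of _ "{b..<b'}"]) (auto simp: F_def)
  have d_le: "d \<le> y" if "(x, y) \<in> F" for x y
    unfolding d_def using fin that by (intro Min_le) force+
  have d_in: "d \<in> insert b' (snd ` F)"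
    unfolding d_def using fin by (intro Min_in) auto
  have "b \<le> d" "d \<le> b'"
    using d_in \<open>b \<le> b'\<close> by (auto simp: F_def)
  moreover have "E \<inter> {a..<a'} \<times> {b..<b'} \<subseteq> E \<inter> {a..<c} \<times> {d..<b'} \<union> E \<inter> {c..<a'} \<times> {b..<d}"
  proof (intro subrelI UnCI)
    fix x y
    assume "(x, y) \<in> E \<inter> {a..<a'} \<times> {b..<b'}"
      and no: "(x, y) \<notin> E \<inter> {c..<a'} \<times> {b..<d}"
    then have xy: "(x, y) \<in> E" "x \<in> {a..<a'}" "y \<in> {b..<b'}" by auto
    \<comment> \<open>Otherwise \<open>d \<le> y < b'\<close>, so \<open>d\<close> is the partner of
      some \<open>z < c\<close>; then \<open>z < x\<close> and \<open>d \<le> y\<close> contradict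
      nestedness.\<close>
    have "x < c"
    proof (rule ccontr)
      assume "\<not> x < c"
      with no xy have "d \<le> y" by auto
      with d_in xy(3) obtain z where z: "(z, d) \<in> F" by auto
      with \<open>\<not> x < c\<close> have "z < x" "(z, d) \<in> E" by (auto simp: F_def)
      with assms(1) xy(1) \<open>d \<le> y\<close> show False
        unfolding nested_def by (metis leD less_imp_not_less prod.inject)
    qed
    with xy have "(x, y) \<in> F" by (auto simp: F_def)
    with d_le[OF this] xy \<open>x < c\<close> show "(x, y) \<in> E \<inter> {a..<c} \<times> {d..<b'}" by auto
  qed
  then have "edges_in E a a' b b' \<le> edges_in E a c d b' + edges_in E c a' b d"
    unfolding edges_in_def of_nat_add[symmetric] of_nat_le_iff
    by (intro order_trans[OF card_mono card_Un_le]) auto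
  ultimately show ?thesis by (rule that)
qed

text \<open>Cutting at the multiples of \<open>d\<close> costs the additive error of one block for every block met.\<close>

lemma edges_in_blocks_fst:
  fixes \<alpha> \<beta> :: "nat \<Rightarrow> real"
  assumes "nested E" "0 < d" "0 \<le> \<gamma>"
    and "a \<le> a'" "b \<le> b'"
    and "\<And>x x' y y'. a \<le> x \<Longrightarrow> x \<le> x' \<Longrightarrow> x' \<le> a' \<Longrightarrow> x' \<le> (x div d + 1) * d \<Longrightarrow>
       b \<le> y \<Longrightarrow> y \<le> y' \<Longrightarrow> y' \<le> b' \<Longrightarrow>
       edges_in E x x' y y' \<le> sum \<alpha> {x..<x'} + sum \<beta> {y..<y'} + \<gamma>"
  shows "edges_in E a a' b b' \<le> sum \<alpha> {a..<a'} + sum \<beta> {b..<b'} + \<gamma> * real (a' div d - a div d + 1)"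
  using assms(4-6)
\<comment> \<open>\<open>b'\<close> varies along with \<open>a\<close>: after the cut at the next
  multiple of \<open>d\<close>, the remaining blocks face only the lower part \<open>{b..<e}\<close>
  of the second side.\<close>
proof (induction "a' - a" arbitrary: a b' rule: less_induct)
  case less
  define c where "c = (a div d + 1) * d"
  show ?case
  proof (cases "a' \<le> c")
    case True
    then have "edges_in E a a' b b' \<le> sum \<alpha> {a..<a'} + sum \<beta> {b..<b'} + \<gamma>"
      using less.prems by (auto simp: c_def)
    also have "\<gamma> \<le> \<gamma> * real (a' div d - a div d + 1)"
      using \<open>0 \<le> \<gamma>\<close> by (simp add: algebra_simps)
    finally show ?thesis by simp
  next
    case False
    have "a < c"
      using dividend_less_div_times[OF \<open>0 < d\<close>, of a] by (simp add: c_def)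
    have cd: "c div d = a div d + 1"
      using \<open>0 < d\<close> by (simp add: c_def)
    have "c div d \<le> a' div d"
      using False by (intro div_le_mono) auto
    then have count: "a' div d - c div d + 1 = a' div d - a div d" "a div d < a' div d"
      using cd by auto
    obtain e where e: "b \<le> e" "e \<le> b'"
      "edges_in E a a' b b' \<le> edges_in E a c e b' + edges_in E c a' b e"
      using nested_split[OF assms(1) less.prems(2)] by blast
    have "edges_in E a c e b' \<le> sum \<alpha> {a..<c} + sum \<beta> {e..<b'} + \<gamma>"
      using less.prems e False \<open>a < c\<close> by (intro less.prems(3)) (auto simp: c_def)
    moreover have "edges_in E c a' b e \<le>
        sum \<alpha> {c..<a'} + sum \<beta> {b..<e} + \<gamma> * real (a' div d - c div d + 1)"
      using less.prems e False \<open>a < c\<close> by (intro less.hyps) auto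
    moreover have "sum \<alpha> {a..<c} + sum \<alpha> {c..<a'} = sum \<alpha> {a..<a'}"
      using False \<open>a < c\<close> by (intro sum.atLeastLessThan_concat) auto
    moreover have "sum \<beta> {b..<e} + sum \<beta> {e..<b'} = sum \<beta> {b..<b'}"
      using e by (intro sum.atLeastLessThan_concat) auto
    ultimately show ?thesis
      using e(3) count(2) unfolding count(1) by (simp add: algebra_simps)
  qed
qed

lemma edges_in_blocks_snd:
  fixes \<alpha> \<beta> :: "nat \<Rightarrow> real"
  assumes "nested E" "0 < d" "0 \<le> \<gamma>"
    and "a \<le> a'" "b \<le> b'"
    and "\<And>x x' y y'. a \<le> x \<Longrightarrow> x \<le> x' \<Longrightarrow> x' \<le> a' \<Longrightarrow> b \<le> y \<Longrightarrow> y \<le> y' \<Longrightarrow> y' \<le> b' \<Longrightarrow>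
       y' \<le> (y div d + 1) * d \<Longrightarrow>
       edges_in E x x' y y' \<le> sum \<alpha> {x..<x'} + sum \<beta> {y..<y'} + \<gamma>"
  shows "edges_in E a a' b b' \<le> sum \<alpha> {a..<a'} + sum \<beta> {b..<b'} + \<gamma> * real (b' div d - b div d + 1)"
  using edges_in_blocks_fst[OF nested_converse[OF assms(1)] assms(2,3,5,4), of \<beta> \<alpha>] assms(6)
  by (simp add: edges_in_converse add_ac)

text \<open>Complete blocks have density at most \<rho>; the incomplete ones at the two ends
  contribute at most \<open>d\<close> each because \<open>g\<close> is at most 1.\<close>

lemma sum_blocks_le:
  fixes g :: "nat \<Rightarrow> real"
  assumes "0 < d" "0 \<le> \<rho>" "\<And>k. g k \<le> 1" "a \<le> a'"
    and full: "\<And>m. a \<le> m * d \<Longrightarrow> (m + 1) * d \<le> a' \<Longrightarrow> sum g {m * d..<(m + 1) * d} \<le> \<rho> * real d"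
  shows "sum g {a..<a'} \<le> \<rho> * real (a' - a) + 2 * real d"
proof -
  have part: "sum g {x..<y} \<le> real d" if "y \<le> x + d" for x y
  proof -
    have "sum g {x..<y} \<le> real (card {x..<y}) * 1"
      by (rule sum_bounded_above) (use assms(3) in auto)
    also have "\<dots> \<le> real d" using that by auto
    finally show ?thesis .
  qed
  \<comment> \<open>From a multiple of \<open>d\<close> onwards only the right end can be
    incomplete, hence a single error \<open>d\<close>.\<close>
  have aligned: "sum g {m * d..<y} \<le> \<rho> * real (y - m * d) + real d"
    if "a \<le> m * d" "m * d \<le> y" "y \<le> a'" for m y
    using that
  proof (induction "y - m * d" arbitrary: m rule: less_induct)
    case less
    show ?case
    proof (cases "y \<le> (m + 1) * d")
      case True
      have "0 \<le> \<rho> * real (y - m * d)" using assms(2) by simp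
      then show ?thesis using part[of y "m * d"] True by simp
    next
      case False
      have "sum g {(m + 1) * d..<y} \<le> \<rho> * real (y - (m + 1) * d) + real d"
        using less.prems False \<open>0 < d\<close> by (intro less.hyps) auto
      moreover have "sum g {m * d..<(m + 1) * d} \<le> \<rho> * real d"
        using less.prems False by (intro full) auto
      moreover have "sum g {m * d..<(m + 1) * d} + sum g {(m + 1) * d..<y} = sum g {m * d..<y}"
        using False by (intro sum.atLeastLessThan_concat) auto
      moreover have "real (y - m * d) = real d + real (y - (m + 1) * d)"
        using False by (simp add: of_nat_diff)
      ultimately show ?thesis by (simp add: distrib_left del: mult_Suc)
    qed
  qed
  define c where "c = (a div d + 1) * d"
  have "a < c" "c \<le> a + d"
    using dividend_less_div_times[OF \<open>0 < d\<close>, of a] by (simp_all add: c_def)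
  show ?thesis
  proof (cases "a' \<le> c")
    case True
    then have "sum g {a..<a'} \<le> real d" using \<open>c \<le> a + d\<close> by (intro part) auto
    moreover have "0 \<le> \<rho> * real (a' - a)" using assms(2) by simp
    ultimately show ?thesis by simp
  next
    case False
    have "sum g {c..<a'} \<le> \<rho> * real (a' - c) + real d"
      unfolding c_def using \<open>a < c\<close> False by (intro aligned) (auto simp: c_def)
    moreover have "\<rho> * real (a' - c) \<le> \<rho> * real (a' - a)"
      using \<open>a < c\<close> assms(2) by (intro mult_left_mono) auto
    moreover have "sum g {a..<c} \<le> real d"
      using \<open>c \<le> a + d\<close> by (intro part) auto
    moreover have "sum g {a..<c} + sum g {c..<a'} = sum g {a..<a'}"
      using False \<open>a < c\<close> by (intro sum.atLeastLessThan_concat) auto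
    ultimately show ?thesis by simp
  qed
qed

subsection \<open>Words with large, small and tiny scales\<close>

lemma switch_switch [simp]: "switch (switch c) = c"
  by (cases c) auto

lemma switch_neq [simp]: "switch c \<noteq> c" "c \<noteq> switch c"
  by (cases c; simp)+

lemma switch_eq_iff: "switch c = d \<longleftrightarrow> c \<noteq> d"
  by (cases c; cases d) auto

definition minority :: real where
  "minority = 1 - 1 / sqrt 2"

lemma minority_bounds: "0 < minority" "minority \<le> 1 / 2"
proof -
  have "1 < sqrt 2" by simp
  then show "0 < minority" by (simp add: minority_def)
  have "sqrt 2 \<le> 2" using real_sqrt_le_mono[of 2 4] by simp
  then show "minority \<le> 1 / 2" by (simp add: minority_def field_simps)
qed

text \<open>Origin of the constant: it is the smaller root of 2 x^2 - 4 x + 1 = 0. Of the edges at a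
  majority run, a share 2\<lambda> is paid by the coarse beads; the remaining share 1 - 2\<lambda>,
  at density 1 - \<lambda>, costs exactly \<lambda> per fine bead.\<close>

lemma minority_eq: "(1 - 2 * minority) * (1 - minority) = minority"
  unfolding minority_def by (simp add: field_simps)


section \<open>Counting in blocks of a fixed length\<close>

lemma div_eq_between:
  fixes a k a' d :: nat
  assumes "a \<le> k" "k < a'" "a' \<le> (a div d + 1) * d"
  shows "k div d = a div d"
proof (rule antisym)
  show "a div d \<le> k div d" using assms by (intro div_le_mono) auto
  have "k div d < a div d + 1"
    using assms by (intro less_mult_imp_div_less) auto
  then show "k div d \<le> a div d" by simp
qed

text \<open>The left side counts the blocks from that of \<open>a\<close> to that of
  \<open>a'\<close>; the 2 pays for the incomplete blocks at the ends.\<close>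

lemma div_diff_le:
  fixes a a' d :: nat
  assumes "0 < d" "a \<le> a'"
  shows "real (a' div d - a div d + 1) \<le> real (a' - a) / real d + 2"
proof -
  have "real (a' div d) \<le> real a' / real d" "real a / real d < real (a div d) + 1"
    using div_times_less_eq_dividend[of a' d] dividend_less_div_times[OF assms(1), of a] assms(1)
    by (simp_all add: field_simps flip: of_nat_add of_nat_mult of_nat_Suc)
  moreover have "a div d \<le> a' div d" using assms by (intro div_le_mono)
  ultimately show ?thesis using assms by (simp add: of_nat_diff diff_divide_distrib)
qed

lemma count_block:
  fixes w m :: nat and P :: "nat \<Rightarrow> bool"
  shows "(\<Sum>k = m * w..<(m + 1) * w. (of_bool (P (k mod w)) :: real)) = real (card {t. t < w \<and> P t})"
proof -
  have "(\<Sum>k = m * w..<(m + 1) * w. (of_bool (P (k mod w)) :: real)) =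
      (\<Sum>t = 0..<w. of_bool (P ((t + m * w) mod w)))"
    using sum.shift_bounds_nat_ivl[of "\<lambda>k. of_bool (P (k mod w)) :: real" 0 "m * w" w]
    by (simp add: add_ac)
  also have "\<dots> = (\<Sum>t = 0..<w. of_bool (P t))"
    by (intro sum.cong) auto
  also have "\<dots> = real (card {t. t < w \<and> P t})"
    by (simp add: of_bool_def sum.If_cases) (simp add: Int_def)
  finally show ?thesis .
qed

text \<open>Position \<open>k\<close> lies in the large arc \<open>i = k div M mod s\<close>, whose small arcs and tiny intervals have
  lengths \<open>S i\<close> and \<open>W i\<close>, with the first \<open>G i\<close> beads of a tiny interval in the main color of the small
  arc. A bead of color \<open>c\<close> is matched with beads of color \<open>h c\<close>. The parameter \<open>T\<close> only serves to
  bound all \<open>S i / s\<close>.\<close>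

locale multiscale_word =
  fixes s M T :: nat and S W G :: "nat \<Rightarrow> nat" and col main :: "nat \<Rightarrow> color"
    and h :: "color \<Rightarrow> color"
  assumes s_pos: "0 < s"
    and W_pos: "\<And>i. i < s \<Longrightarrow> 0 < W i"
    and W_dvd: "\<And>i. i < s \<Longrightarrow> W i dvd S i"
    and S_dvd: "\<And>i. i < s \<Longrightarrow> 2 * S i dvd M"
    and S_mono: "\<And>i j. i < j \<Longrightarrow> j < s \<Longrightarrow> s * S i \<le> S j"
    and W_anti: "\<And>i j. i < j \<Longrightarrow> j < s \<Longrightarrow> s * W j \<le> W i"
    and W_le: "\<And>i. i < s \<Longrightarrow> s * W i \<le> S i"
    and S_le: "\<And>i. i < s \<Longrightarrow> S i \<le> s * T"
    and M_pos: "0 < M"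
    and G_le: "\<And>i. i < s \<Longrightarrow> G i \<le> W i"
    and G_up: "\<And>i. i < s \<Longrightarrow> real (G i) \<le> (1 - minority + 1 / s) * real (W i)"
    and G_low: "\<And>i. i < s \<Longrightarrow> real (W i - G i) \<le> minority * real (W i)"
    and main_eq: "\<And>j. main (Suc j) = switch (main j)"
    and col_eq: "\<And>k. col k = (let i = (k div M) mod s; c = main (k div S i) in
      if k mod W i < G i then c else switch c)"
    and h_h: "\<And>c. h (h c) = c"
begin

definition idx :: "nat \<Rightarrow> nat" where "idx k = (k div M) mod s"

lemma idx_less: "idx k < s"
  using s_pos by (simp add: idx_def)

lemma col_idx: "col k = (if k mod W (idx k) < G (idx k) then main (k div S (idx k))
    else switch (main (k div S (idx k))))"
  by (simp add: col_eq idx_def Let_def)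

section \<open>Color frequencies on the fine and on the coarse side\<close>

lemma S_pos: "i < s \<Longrightarrow> 0 < S i"
  using S_dvd[of i] M_pos by (metis dvd_0_left mult_0_right neq0_conv)


lemma S_div_eq:
  assumes "i < s" "k div W i = k' div W i"
  shows "k div S i = k' div S i"
proof -
  obtain f where "S i = W i * f" using W_dvd[OF assms(1)] by (auto elim: dvdE)
  then show ?thesis by (simp add: div_mult2_eq assms(2))
qed

text \<open>Inside a small arc of main color \<open>c\<close>, every complete tiny interval has
  exactly \<open>G j\<close> beads of color \<open>c\<close>; the incomplete ones at the ends cost
  \<open>2 * W j\<close>.\<close>

lemma count_small:
  assumes j: "j < s" "y \<le> y'"
    and Y: "\<And>k. k \<in> {y..<y'} \<Longrightarrow> idx k = j" "\<And>k. k \<in> {y..<y'} \<Longrightarrow> main (k div S j) = c"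
  shows "(\<Sum>k = y..<y'. (of_bool (col k = c) :: real)) \<le> (1 - minority + 1 / s) * real (y' - y) + 2 * real (W j)"
    and "(\<Sum>k = y..<y'. (of_bool (col k \<noteq> c) :: real)) \<le> minority * real (y' - y) + 2 * real (W j)"
proof -
  have *: "col k = c \<longleftrightarrow> k mod W j < G j" if "k \<in> {y..<y'}" for k
    using Y(1)[OF that] Y(2)[OF that] by (simp add: col_idx)
  show "(\<Sum>k = y..<y'. (of_bool (col k = c) :: real)) \<le> (1 - minority + 1 / s) * real (y' - y) + 2 * real (W j)"
  proof (rule sum_blocks_le)
    fix m assume m: "y \<le> m * W j" "(m + 1) * W j \<le> y'"
    have "(\<Sum>k = m * W j..<(m + 1) * W j. (of_bool (col k = c) :: real)) =
        (\<Sum>k = m * W j..<(m + 1) * W j. (of_bool (k mod W j < G j) :: real))"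
      using m * by (intro sum.cong) auto
    also have "\<dots> = real (card {t. t < W j \<and> t < G j})" by (rule count_block)
    also have "{t. t < W j \<and> t < G j} = {..<G j}" using G_le[OF j(1)] by auto
    finally show "(\<Sum>k = m * W j..<(m + 1) * W j. (of_bool (col k = c) :: real)) \<le> (1 - minority + 1 / s) * W j"
      using G_up[OF j(1)] by simp
  qed (use W_pos[OF j(1)] j(2) minority_bounds in auto)
  show "(\<Sum>k = y..<y'. (of_bool (col k \<noteq> c) :: real)) \<le> minority * real (y' - y) + 2 * real (W j)"
  proof (rule sum_blocks_le)
    fix m assume m: "y \<le> m * W j" "(m + 1) * W j \<le> y'"
    have "(\<Sum>k = m * W j..<(m + 1) * W j. (of_bool (col k \<noteq> c) :: real)) =
        (\<Sum>k = m * W j..<(m + 1) * W j. (of_bool (\<not> k mod W j < G j) :: real))"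
      using m * by (intro sum.cong) auto
    also have "\<dots> = real (card {t. t < W j \<and> \<not> t < G j})" by (rule count_block)
    also have "{t. t < W j \<and> \<not> t < G j} = {G j..<W j}" by auto
    finally show "(\<Sum>k = m * W j..<(m + 1) * W j. (of_bool (col k \<noteq> c) :: real)) \<le> minority * W j"
      using G_low[OF j(1)] by simp
  qed (use W_pos[OF j(1)] j(2) minority_bounds in auto)
qed

text \<open>Beads at distance \<open>S i\<close> have the same place in their tiny intervals but lie
  in neighboring small arcs of opposite main color. So a block of two small arcs contains both
  colors equally often.\<close>

lemma count_fav:
  assumes i: "i < s" "x \<le> x'" and X: "\<And>k. k \<in> {x..<x'} \<Longrightarrow> idx k = i"
  shows "(\<Sum>k = x..<x'. (of_bool (col k = e) :: real)) \<le> 1 / 2 * real (x' - x) + 4 * real (S i)"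
proof -
  have "(\<Sum>k = x..<x'. (of_bool (col k = e) :: real)) \<le> 1 / 2 * real (x' - x) + 2 * real (2 * S i)"
  proof (rule sum_blocks_le)
    fix m assume m: "x \<le> m * (2 * S i)" "(m + 1) * (2 * S i) \<le> x'"
    define b where "b = m * (2 * S i)"
    have sw: "col (k + S i) = switch (col k)" if k: "k \<in> {b..<b + S i}" for k
    proof -
      have "idx k = i" "idx (k + S i) = i"
        using k m by (auto intro!: X simp: b_def)
      moreover have "(k + S i) div S i = Suc (k div S i)" using S_pos[OF i(1)] by simp
      moreover have "(k + S i) mod W i = k mod W i"
        using W_dvd[OF i(1)] by (auto elim!: dvdE)
      ultimately show ?thesis by (simp add: col_idx main_eq)
    qed
    have "(\<Sum>k = b..<b + 2 * S i. (of_bool (col k = e) :: real)) =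
        (\<Sum>k = b..<b + S i. of_bool (col k = e)) + (\<Sum>k = b + S i..<b + S i + S i. of_bool (col k = e))"
      by (subst sum.atLeastLessThan_concat) (auto simp: mult_2 add_ac)
    also have "(\<Sum>k = b + S i..<b + S i + S i. (of_bool (col k = e) :: real)) =
        (\<Sum>k = b..<b + S i. of_bool (col (k + S i) = e))"
      by (rule sum.shift_bounds_nat_ivl)
    also have "(\<Sum>k = b..<b + S i. (of_bool (col k = e) :: real)) + \<dots> = (\<Sum>k = b..<b + S i. 1)"
      unfolding sum.distrib[symmetric] using sw by (intro sum.cong) (auto simp: switch_eq_iff)
    finally show "(\<Sum>k = m * (2 * S i)..<(m + 1) * (2 * S i). (of_bool (col k = e) :: real)) \<le> 1 / 2 * real (2 * S i)"
      by (simp add: b_def add_ac)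
  qed (use S_pos[OF i(1)] i(2) in auto)
  then show ?thesis by simp
qed

text \<open>The beads of the coarse side whose partners have the main color \<open>c\<close> get weight \<open>2 * minority\<close>, its
  other beads weight \<open>0\<close>, and the beads of the fine side weight \<open>minority\<close>. By \<open>minority_eq\<close> these weights cover
  every edge, whether it ends in a majority or in a minority bead.\<close>

lemma run_bound:
  assumes E: "nested E" "\<And>x y. (x, y) \<in> E \<Longrightarrow> col y = h (col x)"
    and j: "j < s" "x \<le> x'" "y \<le> y'"
    and Y: "\<And>k. k \<in> {y..<y'} \<Longrightarrow> idx k = j" "\<And>k. k \<in> {y..<y'} \<Longrightarrow> main (k div S j) = c"
    and X: "\<And>k. k \<in> {x..<x'} \<Longrightarrow> col k = e"
  shows "edges_in E x x' y y' \<le> (\<Sum>k = x..<x'. 2 * minority * of_bool (col k = h c)) +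
    (\<Sum>k = y..<y'. minority + 1 / s) + 2 * real (W j)"
proof -
  have card_sum: "real (card {k \<in> {y..<y'}. P k}) = (\<Sum>k = y..<y'. of_bool (P k))" for P
    by (simp add: of_bool_def sum.If_cases) (simp add: Int_def)
  show ?thesis
  proof (cases "e = h c")
    case True
    have x: "edges_in E x x' y y' \<le> real (x' - x)"
      using edges_in_le_fst[OF E(1), of "{x..<x'}"] by simp
    have "edges_in E x x' y y' \<le> card {k \<in> {y..<y'}. col k = c}"
      by (rule edges_in_le_snd[OF E(1)]) (use E(2) X True h_h in auto)
    also have "\<dots> \<le> (1 - minority + 1 / s) * real (y' - y) + 2 * real (W j)"
      unfolding card_sum using Y by (rule count_small(1)[OF j(1,3)])
    finally have y: "edges_in E x x' y y' \<le> (1 - minority + 1 / s) * real (y' - y) + 2 * real (W j)" .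
    \<comment> \<open>A convex combination of two bounds: the share 2\<lambda> is charged to the run
      on the coarse side, the rest to the beads of color \<open>c\<close> on the fine side.\<close>
    have "edges_in E x x' y y' = 2 * minority * edges_in E x x' y y' + (1 - 2 * minority) * edges_in E x x' y y'"
      by (simp add: algebra_simps)
    also have "\<dots> \<le> 2 * minority * real (x' - x) +
        (1 - 2 * minority) * ((1 - minority + 1 / s) * real (y' - y) + 2 * real (W j))"
      using minority_bounds x y by (intro add_mono mult_left_mono) auto
    also have "(1 - 2 * minority) * ((1 - minority + 1 / s) * real (y' - y) + 2 * real (W j)) =
        minority * real (y' - y) + (1 - 2 * minority) * (1 / s * real (y' - y) + 2 * real (W j))"
    proof -
      have "(1 - 2 * minority) * ((1 - minority + 1 / s) * z + w) =
          (1 - 2 * minority) * (1 - minority) * z + (1 - 2 * minority) * (1 / s * z + w)" for z w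
        by (simp add: algebra_simps)
      then show ?thesis by (simp add: minority_eq)
    qed
    also have "(1 - 2 * minority) * (1 / s * real (y' - y) + 2 * real (W j)) \<le> 1 * (1 / s * real (y' - y) + 2 * real (W j))"
      using minority_bounds by (intro mult_right_mono) auto
    finally have "edges_in E x x' y y' \<le> 2 * minority * real (x' - x) + (minority + 1 / s) * real (y' - y) + 2 * real (W j)"
      by (simp add: algebra_simps)
    moreover have "(\<Sum>k = x..<x'. 2 * minority * of_bool (col k = h c)) = (\<Sum>k = x..<x'. 2 * minority)"
      using X True by (intro sum.cong) auto
    ultimately show ?thesis by (simp add: algebra_simps)
  next
    case False
    \<comment> \<open>The partners now have the minority color, so the fine side alone pays for all
      edges, and the coarse sum is only needed to be nonnegative.\<close>
    have "edges_in E x x' y y' \<le> card {k \<in> {y..<y'}. col k \<noteq> c}"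
      by (rule edges_in_le_snd[OF E(1)]) (use E(2) X False h_h in auto)
    also have "\<dots> \<le> minority * real (y' - y) + 2 * real (W j)"
      unfolding card_sum using Y by (rule count_small(2)[OF j(1,3)])
    also have "\<dots> \<le> (minority + 1 / s) * real (y' - y) + 2 * real (W j)"
      by (simp add: distrib_right)
    moreover have "0 \<le> (\<Sum>k = x..<x'. 2 * minority * of_bool (col k = h c))"
      using minority_bounds by (intro sum_nonneg) auto
    ultimately show ?thesis by (simp add: mult.commute)
  qed
qed

text \<open>A tiny interval on the coarse side consists of at most two monochromatic runs, so one
  cut reduces to \<open>run_bound\<close> twice, each time with error
  \<open>2 * W j\<close>.\<close>

lemma tiny_bound:
  assumes E: "nested E" "\<And>x y. (x, y) \<in> E \<Longrightarrow> col y = h (col x)"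
    and j: "i < s" "j < s" "x \<le> x'" "y \<le> y'"
    and Y: "\<And>k. k \<in> {y..<y'} \<Longrightarrow> idx k = j" "\<And>k. k \<in> {y..<y'} \<Longrightarrow> main (k div S j) = c"
    and X: "\<And>k. k \<in> {x..<x'} \<Longrightarrow> idx k = i" "x' \<le> (x div W i + 1) * W i"
  shows "edges_in E x x' y y' \<le> (\<Sum>k = x..<x'. 2 * minority * of_bool (col k = h c)) +
    (\<Sum>k = y..<y'. minority + 1 / s) + 4 * real (W j)"
proof -
  \<comment> \<open>The place of the color switch, clamped to the range from \<open>x\<close> to
    \<open>x'\<close>, so that one of the two parts may be empty.\<close>
  define r where "r = max x (min x' (x div W i * W i + G i))"
  have r: "x \<le> r" "r \<le> x'" using j by (auto simp: r_def)
  define e where "e = main (x div S i)"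
  have col: "col k = (if k < r then e else switch e)" if k: "k \<in> {x..<x'}" for k
  proof -
    have "k div W i = x div W i" using k X(2) by (intro div_eq_between) auto
    moreover from this have "k div S i = x div S i" by (rule S_div_eq[OF j(1)])
    moreover have "k = k div W i * W i + k mod W i" by simp
    ultimately show ?thesis using k by (auto simp: col_idx X(1) e_def r_def)
  qed
  obtain d where d: "y \<le> d" "d \<le> y'"
    "edges_in E x x' y y' \<le> edges_in E x r d y' + edges_in E r x' y d"
    using nested_split[OF E(1) j(4)] by blast
  have "edges_in E x r d y' \<le> (\<Sum>k = x..<r. 2 * minority * of_bool (col k = h c)) +
    (\<Sum>k = d..<y'. minority + 1 / s) + 2 * real (W j)"
    by (rule run_bound[OF E j(2), where e = e]) (use r d Y col in auto)
  moreover have "edges_in E r x' y d \<le> (\<Sum>k = r..<x'. 2 * minority * of_bool (col k = h c)) +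
    (\<Sum>k = y..<d. minority + 1 / s) + 2 * real (W j)"
    by (rule run_bound[OF E j(2), where e = "switch e"]) (use r d Y col in auto)
  moreover have "(\<Sum>k = x..<x'. 2 * minority * of_bool (col k = h c)) =
      (\<Sum>k = x..<r. 2 * minority * of_bool (col k = h c)) + (\<Sum>k = r..<x'. 2 * minority * of_bool (col k = h c))"
    by (rule sum.atLeastLessThan_concat[symmetric]) (use r in auto)
  moreover have "(\<Sum>k = y..<y'. minority + 1 / s) = (\<Sum>k = y..<d. minority + 1 / s) + (\<Sum>k = d..<y'. minority + 1 / s)"
    by (rule sum.atLeastLessThan_concat[symmetric]) (use d in auto)
  ultimately show ?thesis using d(3) by linarith
qed

text \<open>While the fine side stays inside one small arc, \<open>c\<close> is fixed and the coarse
  side can be cut into tiny intervals. The weight 2\<lambda> on coarse beads of color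
  \<open>h c\<close> then averages to \<lambda>, since by \<open>count_fav\<close> about half of
  them have that color.\<close>

lemma small_bound:
  assumes E: "nested E" "\<And>x y. (x, y) \<in> E \<Longrightarrow> col y = h (col x)"
    and j: "i < j" "j < s" "x \<le> x'" "y \<le> y'"
    and Y: "\<And>k. k \<in> {y..<y'} \<Longrightarrow> idx k = j" "y' \<le> (y div S j + 1) * S j"
    and X: "\<And>k. k \<in> {x..<x'} \<Longrightarrow> idx k = i"
  shows "edges_in E x x' y y' \<le> (minority + 4 / s) * real (x' - x) + (minority + 1 / s) * real (y' - y) +
    (8 * real (W j) + 4 * real (S i))"
proof -
  define c where "c = main (y div S j)"
  have Yc: "main (k div S j) = c" if "k \<in> {y..<y'}" for k
    using div_eq_between[of y k y' "S j"] that Y(2) by (simp add: c_def)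
  have i: "i < s" using j by simp
  have "edges_in E x x' y y' \<le> (\<Sum>k = x..<x'. 2 * minority * of_bool (col k = h c)) +
    (\<Sum>k = y..<y'. minority + 1 / s) + 4 * real (W j) * real (x' div W i - x div W i + 1)"
  proof (rule edges_in_blocks_fst[OF E(1) W_pos[OF i]])
    fix u u' v v'
    assume "x \<le> u" "u \<le> u'" "u' \<le> x'" "u' \<le> (u div W i + 1) * W i" "y \<le> v" "v \<le> v'" "v' \<le> y'"
    then show "edges_in E u u' v v' \<le> (\<Sum>k = u..<u'. 2 * minority * of_bool (col k = h c)) +
      (\<Sum>k = v..<v'. minority + 1 / s) + 4 * real (W j)"
      by (intro tiny_bound[OF E i j(2)]) (use X Y(1) Yc in auto)
  qed (use j in auto)
  moreover have "(\<Sum>k = x..<x'. 2 * minority * of_bool (col k = h c)) \<le> minority * real (x' - x) + 4 * real (S i)"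
  proof -
    have "(\<Sum>k = x..<x'. 2 * minority * of_bool (col k = h c)) =
        2 * minority * (\<Sum>k = x..<x'. of_bool (col k = h c))"
      by (rule sum_distrib_left[symmetric])
    also have "\<dots> \<le> 2 * minority * (1 / 2 * real (x' - x) + 4 * real (S i))"
      using minority_bounds X by (intro mult_left_mono count_fav i j) auto
    also have "\<dots> = minority * real (x' - x) + (2 * minority) * (4 * real (S i))"
      by (simp add: algebra_simps)
    also have "(2 * minority) * (4 * real (S i)) \<le> 1 * (4 * real (S i))"
      using minority_bounds by (intro mult_right_mono) auto
    finally show ?thesis by simp
  qed
  \<comment> \<open>Each tiny interval met costs \<open>4 * W j\<close>. By
    \<open>s * W j \<le> W i\<close> this amounts to 4 / s per coarse bead, apart from the
    incomplete intervals at the ends.\<close>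
  moreover have "4 * real (W j) * real (x' div W i - x div W i + 1) \<le> 4 / s * real (x' - x) + 8 * real (W j)"
  proof -
    have "4 * real (W j) * real (x' div W i - x div W i + 1) \<le> 4 * real (W j) * (real (x' - x) / W i + 2)"
      using W_pos[OF i] j by (intro mult_left_mono div_diff_le) auto
    also have "\<dots> = 4 * (W j / W i) * real (x' - x) + 8 * real (W j)"
      by (simp add: algebra_simps)
    also have "W j / W i \<le> 1 / s"
      using W_anti[OF j(1,2)] W_pos[OF i] s_pos
      by (simp add: field_simps flip: of_nat_mult)
    finally show ?thesis using s_pos by (simp add: mult_right_mono)
  qed
  ultimately show ?thesis by (simp add: algebra_simps)
qed

text \<open>The fine side is cut into small arcs. Each costs \<open>8 * W j + 4 * S i\<close>, at
  most \<open>12 * S j / s\<close>, hence 12 / s per fine bead; the incomplete small arcs at the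
  ends give \<open>24 * T\<close>.\<close>

lemma large_bound_less:
  assumes E: "nested E" "\<And>x y. (x, y) \<in> E \<Longrightarrow> col y = h (col x)"
    and j: "i < j" "j < s" "x \<le> x'" "y \<le> y'"
    and Y: "\<And>k. k \<in> {y..<y'} \<Longrightarrow> idx k = j"
    and X: "\<And>k. k \<in> {x..<x'} \<Longrightarrow> idx k = i"
  shows "edges_in E x x' y y' \<le> (minority + 13 / s) * real (x' - x) + (minority + 13 / s) * real (y' - y) + 24 * real T"
proof -
  have i: "i < s" using j by simp
  let ?g = "real (8 * W j + 4 * S i)"
  have "edges_in E x x' y y' \<le> (\<Sum>k = x..<x'. minority + 4 / s) +
    (\<Sum>k = y..<y'. minority + 1 / s) + ?g * real (y' div S j - y div S j + 1)"
  proof (rule edges_in_blocks_snd[OF E(1) S_pos[OF j(2)]])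
    fix u u' v v'
    assume a: "x \<le> u" "u \<le> u'" "u' \<le> x'" "y \<le> v" "v \<le> v'" "v' \<le> y'" "v' \<le> (v div S j + 1) * S j"
    have "edges_in E u u' v v' \<le> (minority + 4 / s) * real (u' - u) + (minority + 1 / s) * real (v' - v) +
      (8 * real (W j) + 4 * real (S i))"
      by (rule small_bound[OF E j(1,2)]) (use a X Y(1) in auto)
    then show "edges_in E u u' v v' \<le> (\<Sum>k = u..<u'. minority + 4 / s) +
      (\<Sum>k = v..<v'. minority + 1 / s) + ?g"
      by (simp add: mult.commute)
  qed (use j in auto)
  moreover have "?g * real (y' div S j - y div S j + 1) \<le> 12 / s * real (y' - y) + 24 * real T"
  proof -
    have "s * (8 * W j + 4 * S i) \<le> 12 * S j"
      using S_mono[OF j(1,2)] W_le[OF j(2)] by (simp add: distrib_left)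
    then have g: "?g \<le> 12 / s * S j"
      using s_pos by (simp add: field_simps flip: of_nat_mult of_nat_add)
    have "S j / s \<le> real T"
      using S_le[OF j(2)] s_pos by (simp add: field_simps flip: of_nat_mult)
    then have T: "12 / s * S j \<le> 12 * real T" by simp
    have "?g * real (y' div S j - y div S j + 1) \<le> ?g * (real (y' - y) / S j + 2)"
      using S_pos[OF j(2)] j by (intro mult_left_mono div_diff_le) auto
    also have "\<dots> \<le> (12 / s * S j) * (real (y' - y) / S j + 2)"
      using g by (intro mult_right_mono) auto
    also have "\<dots> = 12 / s * real (y' - y) + 2 * (12 / s * S j)"
      using S_pos[OF j(2)] by (simp add: distrib_left)
    finally show ?thesis using T by linarith
  qed
  moreover have "(\<Sum>k = x..<x'. minority + 4 / s) \<le> (minority + 13 / s) * real (x' - x)"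
    using mult_right_mono[of "minority + 4 / s" "minority + 13 / s" "real (x' - x)"]
    by (simp add: mult.commute divide_right_mono)
  moreover have "(\<Sum>k = y..<y'. minority + 1 / s) + 12 / s * real (y' - y) = (minority + 13 / s) * real (y' - y)"
    by (simp add: algebra_simps add_divide_distrib)
  ultimately show ?thesis by linarith
qed

text \<open>Swapping the sides exchanges coarse and fine; the color condition survives because
  \<open>h\<close> is an involution.\<close>

lemma large_bound:
  assumes E: "nested E" "\<And>x y. (x, y) \<in> E \<Longrightarrow> col y = h (col x)"
    and j: "i \<noteq> j" "i < s" "j < s" "x \<le> x'" "y \<le> y'"
    and Y: "\<And>k. k \<in> {y..<y'} \<Longrightarrow> idx k = j"
    and X: "\<And>k. k \<in> {x..<x'} \<Longrightarrow> idx k = i"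
  shows "edges_in E x x' y y' \<le> (minority + 13 / s) * real (x' - x) + (minority + 13 / s) * real (y' - y) + 24 * real T"
proof (cases "i < j")
  case True
  show ?thesis by (rule large_bound_less[OF E True j(3-5) Y X])
next
  case False
  have "edges_in (E\<inverse>) y y' x x' \<le> (minority + 13 / s) * real (y' - y) + (minority + 13 / s) * real (x' - x) + 24 * real T"
    by (rule large_bound_less[OF nested_converse[OF E(1)] _ _ j(2,5,4) X Y]) (use E(2) h_h j False in auto)
  then show ?thesis by (simp add: edges_in_converse)
qed

text \<open>Only the two large arcs cut by the secant can be matched with themselves.\<close>

lemma fold_bound:
  assumes E: "nested E" "\<And>x y. (x, y) \<in> E \<Longrightarrow> col y = h (col x)"
    and PQ: "P \<le> Q" "Q \<le> s * M" "E \<subseteq> {P..<Q} \<times> {Q..<s * M + P}"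
  shows "real (card E) \<le> (minority + 13 / s) * real (s * M) + 24 * real T * real ((s + 1) * (2 * s + 1)) + 2 * real M"
proof -
  \<comment> \<open>Edges whose first end lies in the same block of length \<open>M\<close> as
    \<open>P\<close> or \<open>Q\<close> are set aside.\<close>
  define F where "F = {(x, y) \<in> E. x div M \<noteq> P div M \<and> x div M \<noteq> Q div M}"
  have F: "nested F" "\<And>x y. (x, y) \<in> F \<Longrightarrow> col y = h (col x)"
    using E nested_subset[OF E(1), of F] by (auto simp: F_def)
  \<comment> \<open>Equal indices make the block numbers differ by a multiple of \<open>s\<close>.
    But \<open>x div M < Q div M \<le> y div M \<le> s + P div M < s + x div M\<close> leaves a
    difference strictly between 0 and \<open>s\<close>.\<close>
  have distinct: "idx x \<noteq> idx y" if xy: "(x, y) \<in> F" for x y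
  proof
    assume eq: "idx x = idx y"
    have b: "P \<le> x" "x < Q" "Q \<le> y" "y < s * M + P"
      using xy PQ by (auto simp: F_def)
    have "P div M < x div M"
      using xy b(1) div_le_mono[of P x M] by (auto simp: F_def)
    moreover have "x div M < Q div M"
      using xy b(2) div_le_mono[of x Q M] by (auto simp: F_def)
    moreover have "Q div M \<le> y div M" using b by (intro div_le_mono)
    moreover have "y div M \<le> s + P div M"
      using div_le_mono[of y "s * M + P" M] b M_pos by simp
    moreover have "x div M < s"
      using b PQ M_pos by (intro less_mult_imp_div_less) auto
    ultimately have "x div M < y div M" "y div M < s + x div M" by auto
    moreover have "s dvd (y div M - x div M)"
      using mod_eq_dvd_iff_nat[of "x div M" "y div M" s] \<open>x div M < y div M\<close> eq[symmetric]
      unfolding idx_def by simp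
    ultimately show False
      using nat_dvd_not_less[of "y div M - x div M" s] by linarith
  qed
  have bound: "edges_in F x x' y y' \<le> (\<Sum>k = x..<x'. minority + 13 / s) + (\<Sum>k = y..<y'. minority + 13 / s) + 24 * real T"
    if a: "x \<le> x'" "x' \<le> (x div M + 1) * M" "y \<le> y'" "y' \<le> (y div M + 1) * M" for x x' y y'
  proof -
    have X: "idx k = idx x" if "k \<in> {x..<x'}" for k
      using div_eq_between[of x k x' M] that a by (simp add: idx_def)
    have Y: "idx k = idx y" if "k \<in> {y..<y'}" for k
      using div_eq_between[of y k y' M] that a by (simp add: idx_def)
    show ?thesis
    proof (cases "idx x = idx y")
      case True
      have "(u, v) \<notin> F" if "u \<in> {x..<x'}" "v \<in> {y..<y'}" for u v
        using distinct[of u v] X[OF that(1)] Y[OF that(2)] True by auto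
      then have "F \<inter> {x..<x'} \<times> {y..<y'} = {}" by auto
      then have "edges_in F x x' y y' = 0" by (simp add: edges_in_def)
      moreover have "0 \<le> minority + 13 / s" using minority_bounds by simp
      ultimately show ?thesis by (simp add: sum_nonneg)
    next
      case False
      have "edges_in F x x' y y' \<le> (minority + 13 / s) * real (x' - x) + (minority + 13 / s) * real (y' - y) + 24 * real T"
        by (rule large_bound[OF F False idx_less idx_less a(1,3) Y X])
      then show ?thesis by (simp add: mult.commute)
    qed
  qed
  \<comment> \<open>One block of the first side against the second side, which ends at
    \<open>2 * (s * M)\<close> at the latest and so gives at most \<open>2 * s + 1\<close>
    pieces.\<close>
  have row: "edges_in F x x' y y' \<le> (\<Sum>k = x..<x'. minority + 13 / s) + (\<Sum>k = y..<y'. minority + 13 / s) +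
      24 * real T * real (2 * s + 1)"
    if a: "x \<le> x'" "x' \<le> (x div M + 1) * M" "y \<le> y'" "y' \<le> 2 * (s * M)" for x x' y y'
  proof -
    have "edges_in F x x' y y' \<le> (\<Sum>k = x..<x'. minority + 13 / s) + (\<Sum>k = y..<y'. minority + 13 / s) +
      24 * real T * real (y' div M - y div M + 1)"
    proof (rule edges_in_blocks_snd[OF F(1) M_pos])
      fix u u' v v'
      assume u: "x \<le> u" "u \<le> u'" "u' \<le> x'" "y \<le> v" "v \<le> v'" "v' \<le> y'" "v' \<le> (v div M + 1) * M"
      have "x div M \<le> u div M" using u by (intro div_le_mono)
      then have "(x div M + 1) * M \<le> (u div M + 1) * M" by (intro mult_le_mono1) simp
      then have "u' \<le> (u div M + 1) * M" using u(3) a(2) by linarith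
      then show "edges_in F u u' v v' \<le> (\<Sum>k = u..<u'. minority + 13 / s) + (\<Sum>k = v..<v'. minority + 13 / s) + 24 * real T"
        using u a(4) by (intro bound) auto
    qed (use a in auto)
    also have "y' div M \<le> 2 * s"
      using div_le_mono[OF a(4), of M] M_pos by (simp flip: mult.assoc)
    then have "24 * real T * real (y' div M - y div M + 1) \<le> 24 * real T * real (2 * s + 1)"
      by (intro mult_left_mono) auto
    finally show ?thesis by simp
  qed
  \<comment> \<open>The first side ends at \<open>s * M\<close> at the latest; this gives the other
    factor \<open>s + 1\<close>.\<close>
  have all: "edges_in F P Q Q (s * M + P) \<le> (\<Sum>k = P..<Q. minority + 13 / s) +
      (\<Sum>k = Q..<s * M + P. minority + 13 / s) + 24 * real T * real (2 * s + 1) * real (Q div M - P div M + 1)"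
  proof (rule edges_in_blocks_fst[OF F(1) M_pos])
    fix u u' v v'
    assume "P \<le> u" "u \<le> u'" "u' \<le> Q" "u' \<le> (u div M + 1) * M" "Q \<le> v" "v \<le> v'" "v' \<le> s * M + P"
    then show "edges_in F u u' v v' \<le> (\<Sum>k = u..<u'. minority + 13 / s) + (\<Sum>k = v..<v'. minority + 13 / s) +
        24 * real T * real (2 * s + 1)"
      using PQ by (intro row) auto
  qed (use PQ in auto)
  have "Q div M \<le> s"
    using div_le_mono[OF PQ(2), of M] M_pos by simp
  then have "24 * real T * real (2 * s + 1) * real (Q div M - P div M + 1) \<le> 24 * real T * real (2 * s + 1) * real (s + 1)"
    by (intro mult_left_mono) auto
  with all have "edges_in F P Q Q (s * M + P) \<le>
      (minority + 13 / s) * (real (Q - P) + real (s * M + P - Q)) + 24 * real T * real ((s + 1) * (2 * s + 1))"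
    by (simp add: algebra_simps)
  also have "real (Q - P) + real (s * M + P - Q) = real (s * M)"
    using PQ by (simp add: of_nat_diff)
  finally have cF: "edges_in F P Q Q (s * M + P) \<le> (minority + 13 / s) * real (s * M) + 24 * real T * real ((s + 1) * (2 * s + 1))" .
  have fin: "finite E" using PQ(3) by (rule finite_subset) simp
  have "F \<inter> {P..<Q} \<times> {Q..<s * M + P} = F" using PQ by (auto simp: F_def)
  with cF have cF: "real (card F) \<le> (minority + 13 / s) * real (s * M) + 24 * real T * real ((s + 1) * (2 * s + 1))"
    by (simp add: edges_in_def)
  have block: "x \<in> {m * M..<m * M + M}" if "x div M = m" for x m
    using that div_mult_mod_eq[of x M] mod_less_divisor[OF M_pos, of x] by auto
  \<comment> \<open>The edges set aside have distinct first ends in two blocks of length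
    \<open>M\<close>.\<close>
  have "card (E - F) \<le> card ({P div M * M..<P div M * M + M} \<union> {Q div M * M..<Q div M * M + M})"
  proof (rule card_inj_on_le)
    show "inj_on fst (E - F)" using nested_inj_fst[OF E(1)] by (rule inj_on_subset) auto
    show "fst ` (E - F) \<subseteq> {P div M * M..<P div M * M + M} \<union> {Q div M * M..<Q div M * M + M}"
    proof (rule image_subsetI)
      fix p assume "p \<in> E - F"
      then have "fst p div M = P div M \<or> fst p div M = Q div M" by (auto simp: F_def)
      then show "fst p \<in> {P div M * M..<P div M * M + M} \<union> {Q div M * M..<Q div M * M + M}"
        using block by blast
    qed
  qed simp
  also have "\<dots> \<le> M + M"
    by (rule order_trans[OF card_Un_le]) simp
  finally have "card (E - F) \<le> 2 * M" by simp
  moreover have "card E \<le> card F + card (E - F)"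
  proof -
    have "F \<subseteq> E" by (auto simp: F_def)
    then have "F \<union> (E - F) = E" by blast
    with card_Un_le[of F "E - F"] show ?thesis by simp
  qed
  ultimately show ?thesis using cF by linarith
qed

end

subsection \<open>Folding a proper matching along its secant\<close>

text \<open>An arc of at most \<open>N\<close> beads passes from the last position to 0 at most
  once. If it does not, it is an interval; if it does, its complement is one.\<close>

lemma arc_or_complement_interval:
  assumes "secant N A B"
  obtains P Q where "P \<le> Q" "Q \<le> N"
    "A = {P..<Q} \<and> B = {..<N} - {P..<Q} \<or> B = {P..<Q} \<and> A = {..<N} - {P..<Q}"
proof -
  from assms have B: "B = {..<N} - A"
    by (auto simp: secant_def disjnt_def)
  from assms obtain p0 m where m: "m \<le> N" "A = (\<lambda>k. (p0 + k) mod N) ` {..<m}"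
    by (auto simp: secant_def is_arc_def)
  show ?thesis
  proof (cases "N = 0")
    case True
    with B m show ?thesis by (intro that[of 0 0]) auto
  next
    case False
    define p where "p = p0 mod N"
    have p: "p < N" using False by (simp add: p_def)
    have A: "A = (\<lambda>k. (p + k) mod N) ` {..<m}"
      unfolding m(2) p_def by (simp add: mod_add_left_eq)
    show ?thesis
    proof (cases "p + m \<le> N")
      case True
      have "A = (\<lambda>k. p + k) ` {..<m}"
        unfolding A using True by (intro image_cong) auto
      also have "\<dots> = {p..<p + m}"
        by (simp add: lessThan_atLeast0 add.commute)
      finally have "A = {p..<p + m}" .
      with B True show ?thesis by (intro that[of p "p + m"]) auto
    next
      case False
      have A': "A = {..<N} - {p + m - N..<p}"
      proof (intro set_eqI iffI)
        fix x assume "x \<in> A"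
        then obtain k where k: "k < m" "x = (p + k) mod N" by (auto simp: A)
        show "x \<in> {..<N} - {p + m - N..<p}"
        proof (cases "p + k < N")
          case True
          then show ?thesis using k by auto
        next
          case False
          then have "x = p + k - N" using k m p by (simp add: le_mod_geq)
          then show ?thesis using k m p False by auto
        qed
      next
        fix x assume x: "x \<in> {..<N} - {p + m - N..<p}"
        show "x \<in> A"
        proof (cases "p \<le> x")
          case True
          with x show ?thesis unfolding A using False by (intro image_eqI[of _ _ "x - p"]) auto
        next
          case x_less: False
          have "x < p + m - N" using x x_less by auto
          with x p m show ?thesis unfolding A by (intro image_eqI[of _ _ "x + N - p"]) auto
        qed
      qed
      then have "B = {p + m - N..<p}" using B p by auto
      with A' p m show ?thesis by (intro that[of "p + m - N" p]) auto
    qed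
  qed
qed

text \<open>Folding the necklace along the secant: the arc outside \<open>{P..<Q}\<close> is unrolled to
  \<open>{Q..<N + P}\<close>, so that a proper matching becomes a decreasing sequence of pairs.\<close>

lemma proper_matching_nested:
  assumes M: "M \<in> proper_matchings R L" and R: "\<And>c d. R c d \<longleftrightarrow> d = h c" "\<And>c. h (h c) = c"
  obtains P Q E where "P \<le> Q" "Q \<le> length L" "E \<subseteq> {P..<Q} \<times> {Q..<length L + P}" "nested E"
    "\<And>x y. (x, y) \<in> E \<Longrightarrow> L ! (y mod length L) = h (L ! x)" "card E = card M"
proof -
  define N where "N = length L"
  from M have mat: "matching R L M" and cf: "cross_free N M"
    by (auto simp: proper_matchings_def N_def)
  from M obtain A B where AB: "secant N A B" "secant_respecting A B M"
    by (auto simp: proper_matchings_def N_def)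
  obtain P Q where PQ: "P \<le> Q" "Q \<le> N"
    "A = {P..<Q} \<and> B = {..<N} - {P..<Q} \<or> B = {P..<Q} \<and> A = {..<N} - {P..<Q}"
    using arc_or_complement_interval[OF AB(1)] by blast
  \<comment> \<open>Edges are oriented: first the end in \<open>{P..<Q}\<close>, then the other end,
    where beads before \<open>P\<close> are moved up by \<open>N\<close>.\<close>
  define E where "E = {(x, y). P \<le> x \<and> x < Q \<and> Q \<le> y \<and> y < N + P \<and> {x, y mod N} \<in> M}"
  have modN: "y mod N = (if y < N then y else y - N)" if "y < N + P" for y
    using that PQ by (auto simp: le_mod_geq)
  have notin: "\<not> (P \<le> y mod N \<and> y mod N < Q)" "y mod N < N" if "Q \<le> y" "y < N + P" for y
    using that PQ by (auto simp: modN)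
  have inj: "y = y'" if "y mod N = y' mod N" "Q \<le> y" "y < N + P" "Q \<le> y'" "y' < N + P" for y y'
    using that PQ by (auto simp: modN split: if_splits)
  have disj: "disjnt e f" if "e \<in> M" "f \<in> M" "e \<noteq> f" for e f
    using mat that by (auto simp: matching_def pairwise_def)
  have pair_neq: "{x, y mod N} \<noteq> {x', y' mod N}"
    if "(x, y) \<in> E" "(x', y') \<in> E" "(x, y) \<noteq> (x', y')" for x y x' y'
    using that notin[of y] notin[of y'] inj[of y y'] by (auto simp: E_def doubleton_eq_iff)
  \<comment> \<open>If both coordinates increased, the arc clockwise from \<open>x\<close> to
    \<open>y mod N\<close> would contain \<open>x'\<close> but not \<open>y' mod N\<close>, so the
    two edges would cross.\<close>
  have nested_less: False
    if "(x, y) \<in> E" "(x', y') \<in> E" "x < x'" "y < y'" for x y x' y'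
  proof -
    from that have xy: "P \<le> x" "x < Q" "Q \<le> y" "y < N + P" "{x, y mod N} \<in> M"
      "P \<le> x'" "x' < Q" "Q \<le> y'" "y' < N + P" "{x', y' mod N} \<in> M"
      by (auto simp: E_def)
    have "{x, y mod N} \<noteq> {x', y' mod N}" using pair_neq that by blast
    with cf xy have "disjnt (between N x (y mod N)) {x', y' mod N} \<and> {x', y' mod N} \<subseteq> between N (y mod N) x \<or>
        disjnt (between N (y mod N) x) {x', y' mod N} \<and> {x', y' mod N} \<subseteq> between N x (y mod N)"
      unfolding cross_free_def by blast
    moreover have "x' \<in> between N x (y mod N)"
      using xy that PQ by (auto simp: between_def modN)
    moreover have "y' mod N \<notin> between N x (y mod N)"
      using xy that PQ by (auto simp: between_def modN)
    ultimately show False by (auto simp: disjnt_def)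
  qed
  have "nested E"
    unfolding nested_def
  proof (intro allI impI)
    fix a b c d
    assume E: "(a, b) \<in> E" "(c, d) \<in> E" "(a, b) \<noteq> (c, d)"
    then have "disjnt {a, b mod N} {c, d mod N}"
      using pair_neq[OF E] by (intro disj) (auto simp: E_def)
    then have "a \<noteq> c" "b \<noteq> d" by (auto simp: disjnt_def)
    with nested_less[OF E(1,2)] nested_less[OF E(2,1)]
    show "a < c \<and> d < b \<or> c < a \<and> b < d" by (meson linorder_neqE_nat)
  qed
  moreover have "L ! (y mod N) = h (L ! x)" if "(x, y) \<in> E" for x y
  proof -
    from that have "{x, y mod N} \<in> M" by (simp add: E_def)
    with mat obtain a b where "{x, y mod N} = {a, b}" "R (L ! a) (L ! b)"
      unfolding matching_def by blast
    with R show ?thesis by (auto simp: doubleton_eq_iff)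
  qed
  moreover have "card E = card M"
  proof (rule bij_betw_same_card[of "\<lambda>(x, y). {x, y mod N}"])
    have "inj_on (\<lambda>(x, y). {x, y mod N}) E"
      using pair_neq by (auto simp: inj_on_def)
    moreover have "(\<lambda>(x, y). {x, y mod N}) ` E = M"
    proof (intro set_eqI iffI)
      fix e assume "e \<in> M"
      then obtain a b where "a \<in> A" "b \<in> B" "e = {a, b}"
        using AB(2) by (auto simp: secant_respecting_def)
      with PQ(3) obtain x z where x: "P \<le> x" "x < Q" "z < N" "\<not> (P \<le> z \<and> z < Q)" "e = {x, z}"
        by (auto simp: insert_commute)
      define y where "y = (if z < P then z + N else z)"
      have "(x, y) \<in> E" "e = {x, y mod N}"
        using x \<open>e \<in> M\<close> PQ by (auto simp: E_def y_def)
      then show "e \<in> (\<lambda>(x, y). {x, y mod N}) ` E" by force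
    qed (auto simp: E_def)
    ultimately show "bij_betw (\<lambda>(x, y). {x, y mod N}) E M" by (simp add: bij_betw_def)
  qed
  moreover have "E \<subseteq> {P..<Q} \<times> {Q..<N + P}" by (auto simp: E_def)
  ultimately show ?thesis using PQ by (intro that[of P Q E]) (auto simp: N_def)
qed

section \<open>Existence of a largest proper matching\<close>

lemma finite_proper_matchings: "finite (proper_matchings R L)"
proof (rule finite_subset)
  show "proper_matchings R L \<subseteq> Pow (Pow {..<length L})"
    by (force simp: proper_matchings_def matching_def)
qed simp

lemma empty_in_proper_matchings: "{} \<in> proper_matchings R L"
proof -
  let ?N = "length L"
  have "is_arc ?N {..<?N}"
    unfolding is_arc_def by (intro exI[of _ 0] exI[of _ ?N]) auto
  moreover have "is_arc ?N {}"
    unfolding is_arc_def by (intro exI[of _ 0]) auto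
  ultimately have "secant ?N {..<?N} {}" by (simp add: secant_def)
  then show ?thesis
    by (auto simp: proper_matchings_def matching_def cross_free_def secant_respecting_def)
qed

lemma max_proper_size_attained:
  obtains M where "M \<in> proper_matchings R L" "card M = max_proper_size R L"
proof -
  have "max_proper_size R L \<in> card ` proper_matchings R L"
    unfolding max_proper_size_def using finite_proper_matchings[of R L] empty_in_proper_matchings[of R L]
    by (intro Max_in) auto
  then show ?thesis using that by auto
qed

text \<open>The \<open>r\<close> beads from \<open>s * M\<close> on are arbitrary. Edges touching
  them number at most \<open>2 * r\<close>; the others, once the gap is closed, form a nested set on
  the periodic word, where \<open>fold_bound\<close> applies.\<close>

lemma (in multiscale_word) max_proper_size_le:
  assumes len: "length L = s * M + r" and L: "\<And>k. k < s * M \<Longrightarrow> L ! k = col k"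
    and R: "\<And>c d. R c d \<longleftrightarrow> d = h c"
  shows "real (max_proper_size R L) \<le> (minority + 13 / s) * real (s * M) +
    24 * real T * real ((s + 1) * (2 * s + 1)) + 2 * real M + 2 * real r"
proof -
  obtain Mt where Mt: "Mt \<in> proper_matchings R L" "card Mt = max_proper_size R L"
    by (rule max_proper_size_attained)
  obtain P Q E where E: "P \<le> Q" "Q \<le> length L" "E \<subseteq> {P..<Q} \<times> {Q..<length L + P}" "nested E"
    "\<And>x y. (x, y) \<in> E \<Longrightarrow> L ! (y mod length L) = h (L ! x)" "card E = card Mt"
    using proper_matching_nested[OF Mt(1) R h_h] by blast
  let ?N = "s * M"
  \<comment> \<open>\<open>s * M\<close> is a multiple of every \<open>W i\<close> and an even
    multiple of every \<open>S i\<close>, so a full turn changes neither the place in a tiny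
    interval nor the main color.\<close>
  have col_period: "col (k + ?N) = col k" for k
  proof -
    have "(k + ?N) div M = k div M + s" using M_pos by (simp add: add.commute)
    then have "idx (k + ?N) = idx k" by (simp add: idx_def)
    define i where "i = idx k"
    have i: "i < s" by (simp add: i_def idx_less)
    obtain g where g: "M = 2 * S i * g" using S_dvd[OF i] by (auto elim: dvdE)
    obtain f where f: "S i = W i * f" using W_dvd[OF i] by (auto elim: dvdE)
    have N': "?N = W i * (f * 2 * g * s)" by (simp add: g f)
    have "(k + ?N) mod W i = k mod W i" unfolding N' by simp
    moreover have N: "?N = S i * (2 * (g * s))" by (simp add: g)
    have "(k + ?N) div S i = k div S i + 2 * (g * s)" unfolding N using S_pos[OF i] by simp
    moreover have "main (a + 2 * b) = main a" for a b
      by (induction b) (simp_all add: main_eq)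
    ultimately show ?thesis by (simp add: col_idx \<open>idx (k + ?N) = idx k\<close> flip: i_def)
  qed
  have fin: "finite E" using E(3) by (rule finite_subset) simp
  define J where "J = {?N..<?N + r}"
  define F where "F = {(x, y) \<in> E. x \<notin> J \<and> y mod length L \<notin> J}"
  \<comment> \<open>Second ends beyond the segment \<open>J\<close> move down by \<open>r\<close>,
    so that a full turn becomes a shift by \<open>s * M\<close>.\<close>
  define \<phi> where "\<phi> = (\<lambda>(x::nat, y). (x, if y < ?N then y else y - r))"
  define F' where "F' = \<phi> ` F"
  \<comment> \<open>Cuts beyond \<open>s * M\<close> are moved back to it.\<close>
  define P' where "P' = min P ?N"
  define Q' where "Q' = min Q ?N"
  have FE: "F \<subseteq> E" by (auto simp: F_def)
  have Exy: "P \<le> x" "x < Q" "Q \<le> y" "y < length L + P" if "(x, y) \<in> E" for x y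
    using subsetD[OF E(3) that] by auto
  have ymod: "y mod length L = (if y < length L then y else y - length L)" if "(x, y) \<in> E" for x y
    using Exy[OF that] E(1,2) by (auto simp: le_mod_geq)
  have Fxy: "P \<le> x" "x < Q" "Q \<le> y" "y < length L + P" "x < ?N" "y < ?N \<or> ?N + r \<le> y \<and> y < ?N + r + ?N"
    if "(x, y) \<in> F" for x y
    using that Exy[of x y] E(1,2) ymod[of x y] by (auto simp: F_def J_def len split: if_splits)
  have inj: "inj_on \<phi> F"
  proof (rule inj_onI, clarify)
    fix x y x' y' assume F: "(x, y) \<in> F" "(x', y') \<in> F" and eq: "\<phi> (x, y) = \<phi> (x', y')"
    show "x = x' \<and> y = y'"
      using eq Fxy(6)[OF F(1)] Fxy(6)[OF F(2)] by (auto simp: \<phi>_def split: if_splits)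
  qed
  have nF: "nested F" by (rule nested_subset[OF E(4) FE])
  have nF': "nested F'"
    unfolding nested_def
  proof (intro allI impI)
    fix a b c d
    assume ab: "(a, b) \<in> F'" "(c, d) \<in> F'" "(a, b) \<noteq> (c, d)"
    then obtain b' d' where b': "(a, b') \<in> F" "(c, d') \<in> F"
      "b = (if b' < ?N then b' else b' - r)" "d = (if d' < ?N then d' else d' - r)"
      by (auto simp: F'_def \<phi>_def)
    with ab(3) have "(a, b') \<noteq> (c, d')" by auto
    with nF b'(1,2) have "a < c \<and> d' < b' \<or> c < a \<and> b' < d'" unfolding nested_def by blast
    with b' Fxy(6)[OF b'(1)] Fxy(6)[OF b'(2)] show "a < c \<and> d < b \<or> c < a \<and> b < d"
      by auto
  qed
  have colF': "col y = h (col x)" if "(x, y) \<in> F'" for x y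
  proof -
    from that obtain z where z: "(x, z) \<in> F" "y = (if z < ?N then z else z - r)"
      by (auto simp: F'_def \<phi>_def)
    then have "(x, z) \<in> E" using FE by auto
    have "L ! (z mod length L) = col y"
    proof (cases "z < ?N")
      case True
      then show ?thesis using z by (simp add: L len)
    next
      case False
      with Fxy[OF z(1)] have "z mod length L = z - length L" "z - length L < ?N" "y = z - length L + ?N"
        using ymod[OF \<open>(x, z) \<in> E\<close>] z(2) by (auto simp: len)
      then show ?thesis using L col_period by simp
    qed
    with E(5)[OF \<open>(x, z) \<in> E\<close>] L[OF Fxy(5)[OF z(1)]] show ?thesis by simp
  qed
  have sub: "F' \<subseteq> {P'..<Q'} \<times> {Q'..<?N + P'}"
  proof
    fix p assume "p \<in> F'"
    then obtain x z where z: "(x, z) \<in> F" "p = (x, if z < ?N then z else z - r)"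
      by (auto simp: F'_def \<phi>_def)
    show "p \<in> {P'..<Q'} \<times> {Q'..<?N + P'}"
      using Fxy[OF z(1)] z(2) by (auto simp: P'_def Q'_def len)
  qed
  have bF: "real (card F') \<le> (minority + 13 / s) * real (s * M) +
      24 * real T * real ((s + 1) * (2 * s + 1)) + 2 * real M"
    by (rule fold_bound[OF nF' colF' _ _ sub]) (use E in \<open>auto simp: P'_def Q'_def\<close>)
  have "card F' = card F" unfolding F'_def by (rule card_image[OF inj])
  have EF: "E \<subseteq> F \<union> ({(x, y) \<in> E. x \<in> J} \<union> {(x, y) \<in> E. y mod length L \<in> J})"
    by (auto simp: F_def)
  have "card {(x, y) \<in> E. x \<in> J} \<le> card J"
    by (rule card_inj_on_le[OF inj_on_subset[OF nested_inj_fst[OF E(4)]]]) (auto simp: J_def)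
  moreover have "card {(x, y) \<in> E. y mod length L \<in> J} \<le> card J"
  proof (rule card_inj_on_le)
    \<comment> \<open>By \<open>P \<le> Q\<close> the range of second ends has at most
      \<open>length L\<close> elements, so reduction is injective on it.\<close>
    have "y mod length L = (if y < length L then y else y - length L)" if "y \<in> {Q..<length L + P}" for y
      using that E(1,2) by (auto simp: le_mod_geq)
    then have "inj_on (\<lambda>y. y mod length L) {Q..<length L + P}"
      using E(1,2) by (auto simp: inj_on_def split: if_splits)
    then show "inj_on ((\<lambda>y. y mod length L) \<circ> snd) {(x, y) \<in> E. y mod length L \<in> J}"
      using E(3) by (intro comp_inj_on inj_on_subset[OF nested_inj_snd[OF E(4)]]) (auto elim!: inj_on_subset)
  qed (auto simp: J_def)
  moreover have "card E \<le> card F + (card {(x, y) \<in> E. x \<in> J} + card {(x, y) \<in> E. y mod length L \<in> J})"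
  proof -
    have "card E \<le> card (F \<union> ({(x, y) \<in> E. x \<in> J} \<union> {(x, y) \<in> E. y mod length L \<in> J}))"
      by (rule card_mono[OF _ EF]) (use fin FE in \<open>auto intro: finite_subset\<close>)
    also have "\<dots> \<le> card F + (card {(x, y) \<in> E. x \<in> J} + card {(x, y) \<in> E. y mod length L \<in> J})"
      by (intro order_trans[OF card_Un_le] add_left_mono card_Un_le)
    finally show ?thesis .
  qed
  ultimately have "card E \<le> card F' + 2 * r"
    using \<open>card F' = card F\<close> by (simp add: J_def)
  then have "real (card E) \<le> real (card F') + 2 * real r" by linarith
  with bF show ?thesis using E(6) Mt(2) by linarith
qed

subsection \<open>The construction and its blow-ups\<close>

lemma length_concat_blocks:
  assumes "\<And>i. i < n \<Longrightarrow> length (f i) = d"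
  shows "length (concat (map f [0..<n])) = n * d"
  using assms by (induction n) auto

lemma nth_concat_blocks:
  assumes "\<And>i. i < n \<Longrightarrow> length (f i) = d" "k < n * d"
  shows "concat (map f [0..<n]) ! k = f (k div d) ! (k mod d)"
  using assms
proof (induction n)
  case (Suc n)
  have len: "length (concat (map f [0..<n])) = n * d"
    using Suc.prems(1) by (intro length_concat_blocks) auto
  show ?case
  proof (cases "k < n * d")
    case True
    then have "concat (map f [0..<n]) ! k = f (k div d) ! (k mod d)"
      using Suc.prems(1) by (intro Suc.IH) auto
    with True show ?thesis by (simp add: nth_append len)
  next
    case False
    then obtain t where t: "k = n * d + t" using le_Suc_ex not_less by blast
    with Suc.prems(2) have "t < d" by simp
    with t show ?thesis by (simp add: nth_append len)
  qed
qed simp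

text \<open>Here and below \<open>i\<close> counts the large arcs from 0 and stands for the arc
  \<open>Suc i\<close> of the construction.\<close>

definition tiny_length :: "nat \<Rightarrow> nat \<Rightarrow> nat" where
  "tiny_length s i = s ^ (2 * s - Suc i)"

definition tiny_major :: "nat \<Rightarrow> nat \<Rightarrow> nat" where
  "tiny_major s i = tiny_length s i - nat \<lfloor>minority * real (tiny_length s i)\<rfloor>"

definition small_length :: "nat \<Rightarrow> nat \<Rightarrow> nat" where
  "small_length s i = s ^ (3 * s + Suc i)"

definition large_length :: "nat \<Rightarrow> nat" where
  "large_length s = 2 * s ^ (5 * s)"

text \<open>Small arcs are counted from 0 too: an even \<open>j\<close> stands for the odd number
  \<open>Suc j\<close>, hence a red arc.\<close>

definition main_color :: "nat \<Rightarrow> color" where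
  "main_color j = (if even j then Red else Blue)"

lemma small_length_eq: "i < s \<Longrightarrow> small_length s i = s ^ (s + 2 * Suc i) * tiny_length s i"
  unfolding small_length_def tiny_length_def power_add[symmetric]
  by (rule arg_cong[where f = "power s"]) simp

lemma large_length_eq: "i < s \<Longrightarrow> large_length s = 2 * s ^ (2 * s - Suc i) * small_length s i"
  unfolding small_length_def large_length_def mult.assoc power_add[symmetric]
  by (intro arg_cong[where f = "(*) 2"] arg_cong[where f = "power s"]) simp

lemma minority_floor_le: "nat \<lfloor>minority * real w\<rfloor> \<le> w"
proof -
  have "minority * real w \<le> 1 * real w"
    using minority_bounds by (intro mult_right_mono) auto
  then show ?thesis by linarith
qed

lemma length_tiny_interval: "length (tiny_interval minority s (Suc i) c) = tiny_length s i"
  using minority_floor_le[of "tiny_length s i"]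
  by (simp add: tiny_interval_def tiny_length_def Let_def)

lemma nth_tiny_interval:
  "k < tiny_length s i \<Longrightarrow> tiny_interval minority s (Suc i) c ! k = (if k < tiny_major s i then c else switch c)"
  using minority_floor_le[of "tiny_length s i"]
  by (auto simp: tiny_interval_def tiny_length_def[symmetric] tiny_major_def Let_def nth_append)

lemma length_small_arc: "i < s \<Longrightarrow> length (small_arc minority s (Suc i) j) = small_length s i"
  unfolding small_arc_def
  using length_concat_blocks[of "s ^ (s + 2 * Suc i)" "\<lambda>_. tiny_interval minority s (Suc i) (if odd j then Red else Blue)"]
  by (simp add: length_tiny_interval map_replicate_const small_length_eq)

lemma nth_small_arc:
  assumes "i < s" "k < small_length s i"
  shows "small_arc minority s (Suc i) (Suc j) ! k =
    (if k mod tiny_length s i < tiny_major s i then main_color j else switch (main_color j))"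
proof -
  have "0 < tiny_length s i" using assms by (simp add: tiny_length_def)
  then have "k mod tiny_length s i < tiny_length s i" by simp
  then show ?thesis
    unfolding small_arc_def
    using nth_concat_blocks[of "s ^ (s + 2 * Suc i)" "\<lambda>_. tiny_interval minority s (Suc i) (main_color j)"
        "tiny_length s i" k] assms
    by (simp add: length_tiny_interval nth_tiny_interval map_replicate_const small_length_eq main_color_def)
qed

lemma concat_map_shift: "concat (map f [1..<n + 1]) = concat (map (\<lambda>i. f (Suc i)) [0..<n])"
  by (simp add: map_Suc_upt[symmetric] comp_def del: upt_Suc map_Suc_upt)

lemma length_large_arc: "i < s \<Longrightarrow> length (large_arc minority s (Suc i)) = large_length s"
  unfolding large_arc_def concat_map_shift
  by (subst length_concat_blocks[of _ _ "small_length s i"]) (simp_all add: length_small_arc large_length_eq)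

lemma nth_large_arc:
  assumes "i < s" "k < large_length s"
  shows "large_arc minority s (Suc i) ! k =
    (if k mod tiny_length s i < tiny_major s i then main_color (k div small_length s i)
     else switch (main_color (k div small_length s i)))"
proof -
  have pos: "0 < small_length s i" using assms by (simp add: small_length_def)
  have "tiny_length s i dvd small_length s i" using small_length_eq[OF assms(1)] by simp
  then have "k mod small_length s i mod tiny_length s i = k mod tiny_length s i" by (rule mod_mod_cancel)
  moreover have "large_arc minority s (Suc i) ! k =
      small_arc minority s (Suc i) (Suc (k div small_length s i)) ! (k mod small_length s i)"
    unfolding large_arc_def concat_map_shift
    by (rule nth_concat_blocks) (use assms in \<open>simp_all add: length_small_arc large_length_eq\<close>)
  ultimately show ?thesis
    using pos by (simp add: nth_small_arc[OF assms(1)])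
qed

lemma length_construction: "length (construction minority s) = s * large_length s"
  unfolding construction_def concat_map_shift
  by (rule length_concat_blocks) (simp add: length_large_arc)

text \<open>Remainders and quotients refer to the position in the whole necklace. This agrees with
  counting inside a large arc because \<open>tiny_length s i\<close> and twice
  \<open>small_length s i\<close> divide \<open>large_length s\<close>, so places in tiny intervals
  and parities are preserved.\<close>

definition construction_color :: "nat \<Rightarrow> nat \<Rightarrow> color" where
  "construction_color s k = (let i = k div large_length s; c = main_color (k div small_length s i)
     in if k mod tiny_length s i < tiny_major s i then c else switch c)"

lemma nth_construction:
  assumes "k < s * large_length s"
  shows "construction minority s ! k = construction_color s k"
proof -
  define i where "i = k div large_length s"
  have i: "i < s" unfolding i_def using assms by (intro less_mult_imp_div_less)
  have pos: "0 < large_length s" using i by (simp add: large_length_def)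
  have "construction minority s ! k = large_arc minority s (Suc i) ! (k mod large_length s)"
    unfolding construction_def concat_map_shift i_def
    by (rule nth_concat_blocks) (use assms in \<open>simp_all add: length_large_arc\<close>)
  also have "\<dots> = (if k mod large_length s mod tiny_length s i < tiny_major s i
      then main_color (k mod large_length s div small_length s i)
      else switch (main_color (k mod large_length s div small_length s i)))"
    using pos by (intro nth_large_arc i) simp
  also have "k mod large_length s mod tiny_length s i = k mod tiny_length s i"
    by (intro mod_mod_cancel) (simp add: large_length_eq[OF i] small_length_eq[OF i])
  also have "main_color (k mod large_length s div small_length s i) = main_color (k div small_length s i)"
  proof -
    have "0 < small_length s i" using i by (simp add: small_length_def)
    moreover have "large_length s = small_length s i * (2 * s ^ (2 * s - Suc i))"
      using large_length_eq[OF i] by simp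
    ultimately have "k mod large_length s div small_length s i = k div small_length s i mod (2 * s ^ (2 * s - Suc i))"
      by (simp add: mod_mult2_eq)
    then show ?thesis by (simp add: main_color_def dvd_mod_iff)
  qed
  finally show ?thesis by (simp add: construction_color_def i_def[symmetric])
qed

text \<open>Reduces the color test of a blow-up at \<open>k\<close> to the original test at
  \<open>k div q\<close>: the part \<open>k mod q\<close> never decides a comparison with a multiple
  of \<open>q\<close>.\<close>

lemma mod_mult_less_iff:
  fixes k q w g :: nat
  assumes "0 < q"
  shows "k mod (q * w) < q * g \<longleftrightarrow> (k div q) mod w < g"
proof -
  have "k mod (q * w) = q * (k div q mod w) + k mod q" by (rule mod_mult2_eq)
  moreover have "k mod q < q" using assms by simp
  moreover have "q * a + b < q * g \<longleftrightarrow> a < g" if "b < q" for a b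
  proof
    assume "q * a + b < q * g"
    then have "q * a < q * g" by linarith
    then show "a < g" by simp
  next
    assume "a < g"
    then have "q * (a + 1) \<le> q * g" by (intro mult_le_mono2) simp
    with that show "q * a + b < q * g" by simp
  qed
  ultimately show ?thesis by simp
qed

text \<open>All scales are \<open>q\<close> times powers of \<open>s\<close>: as \<open>i\<close>
  grows by one, small arcs lengthen and tiny intervals shrink by the factor
  \<open>s\<close>.\<close>

lemma construction_word:
  assumes "2 \<le> s" "0 < q" "\<And>c. h (h c) = c"
  shows "multiscale_word s (q * large_length s) (q * s ^ (4 * s)) (\<lambda>i. q * small_length s i) (\<lambda>i. q * tiny_length s i)
    (\<lambda>i. q * tiny_major s i)
    (\<lambda>k. let i = (k div (q * large_length s)) mod s; c = main_color (k div (q * small_length s i)) in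
       if k mod (q * tiny_length s i) < q * tiny_major s i then c else switch c) main_color h"
proof
  have s: "1 \<le> s" "0 < s" using assms by auto
  show "0 < s" by (rule s)
  show "0 < q * large_length s" using assms by (simp add: large_length_def)
  show "main_color (Suc j) = switch (main_color j)" for j by (simp add: main_color_def)
  show "h (h c) = c" for c by (rule assms)
  fix i assume i: "i < s"
  show "0 < q * tiny_length s i" using assms by (simp add: tiny_length_def)
  show "q * tiny_length s i dvd q * small_length s i"
    by (simp add: small_length_eq[OF i])
  show "2 * (q * small_length s i) dvd q * large_length s"
    by (simp add: large_length_eq[OF i] mult.left_commute[of 2])
  have "s * tiny_length s i = s ^ Suc (2 * s - Suc i)" by (simp add: tiny_length_def)
  also have "\<dots> \<le> small_length s i"
    unfolding small_length_def by (rule power_increasing[OF _ s(1)]) simp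
  finally show "s * (q * tiny_length s i) \<le> q * small_length s i"
    using mult_le_mono2[of "s * tiny_length s i" "small_length s i" q] by (simp add: ac_simps)
  have "small_length s i \<le> s ^ (4 * s)"
    unfolding small_length_def by (rule power_increasing[OF _ s(1)]) (use i in simp)
  also have "\<dots> \<le> s * s ^ (4 * s)" using s by simp
  finally show "q * small_length s i \<le> s * (q * s ^ (4 * s))"
    using mult_le_mono2[of "small_length s i" "s * s ^ (4 * s)" q] by (simp add: ac_simps)
  show "q * tiny_major s i \<le> q * tiny_length s i" by (simp add: tiny_major_def)
  let ?w = "tiny_length s i"
  \<comment> \<open>A tiny interval has at least \<open>s\<close> beads, so the rounding error of at
    most one bead is at most a share 1 / s of it.\<close>
  have "s ^ 1 \<le> ?w"
    unfolding tiny_length_def by (rule power_increasing[OF _ s(1)]) (use i in simp)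
  then have w: "1 \<le> 1 / real s * real ?w" using s by simp
  have f: "real (tiny_major s i) = real ?w - real (nat \<lfloor>minority * real ?w\<rfloor>)"
    using minority_floor_le[of ?w] by (simp add: tiny_major_def of_nat_diff)
  have nn: "0 \<le> minority * real ?w" using minority_bounds by simp
  have "real (tiny_major s i) \<le> real ?w - (minority * real ?w - 1)"
    using f nn by linarith
  also have "\<dots> \<le> (1 - minority + 1 / real s) * real ?w"
    using w by (simp add: algebra_simps)
  finally have "real q * real (tiny_major s i) \<le> real q * ((1 - minority + 1 / real s) * real ?w)"
    by (intro mult_left_mono) auto
  then show "real (q * tiny_major s i) \<le> (1 - minority + 1 / real s) * real (q * ?w)"
    by (simp add: ac_simps)
  have "tiny_length s i - tiny_major s i = nat \<lfloor>minority * real ?w\<rfloor>"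
    using minority_floor_le[of ?w] by (simp add: tiny_major_def)
  then have "real (tiny_length s i - tiny_major s i) \<le> minority * real ?w"
    using nn by linarith
  then have "real q * real (tiny_length s i - tiny_major s i) \<le> real q * (minority * real ?w)"
    by (intro mult_left_mono) auto
  then show "real (q * ?w - q * tiny_major s i) \<le> minority * real (q * ?w)"
    by (simp add: ac_simps flip: diff_mult_distrib2)
next
  have s: "1 \<le> s" using assms by auto
  fix i j assume ij: "i < j" "j < s"
  have "s * small_length s i = s ^ Suc (3 * s + Suc i)" by (simp add: small_length_def)
  also have "\<dots> \<le> small_length s j"
    unfolding small_length_def by (rule power_increasing[OF _ s]) (use ij in simp)
  finally show "s * (q * small_length s i) \<le> q * small_length s j"
    using mult_le_mono2[of "s * small_length s i" "small_length s j" q] by (simp add: ac_simps)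
  have "s * tiny_length s j = s ^ Suc (2 * s - Suc j)" by (simp add: tiny_length_def)
  also have "\<dots> \<le> tiny_length s i"
    unfolding tiny_length_def by (rule power_increasing[OF _ s]) (use ij in simp)
  finally show "s * (q * tiny_length s j) \<le> q * tiny_length s i"
    using mult_le_mono2[of "s * tiny_length s j" "tiny_length s i" q] by (simp add: ac_simps)
qed simp

text \<open>Of the 2 q n structured beads the main term takes 2\<lambda> q n, and 2\<lambda> = 2 -
  sqrt 2. The 174 collects 26 from 13 / s on 2 q n beads, 144 from the cuts and 4 from the edges set
  aside in \<open>fold_bound\<close>.\<close>

lemma max_proper_size_blowup:
  assumes s: "2 \<le> s" and q: "0 < q" and h: "\<And>c. h (h c) = c" "\<And>c d. R c d \<longleftrightarrow> d = h c"
    and L: "length L = 2 * q * s ^ (5 * s + 1) + r"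
      "\<And>k. k < 2 * q * s ^ (5 * s + 1) \<Longrightarrow> L ! k = construction minority s ! (k div q)"
  shows "real (max_proper_size R L) \<le>
    (2 - sqrt 2 + 174 / s) * (real q * real (s ^ (5 * s + 1))) + 2 * real r"
proof -
  interpret multiscale_word s "q * large_length s" "q * s ^ (4 * s)" "\<lambda>i. q * small_length s i" "\<lambda>i. q * tiny_length s i"
    "\<lambda>i. q * tiny_major s i"
    "\<lambda>k. let i = (k div (q * large_length s)) mod s; c = main_color (k div (q * small_length s i)) in
       if k mod (q * tiny_length s i) < q * tiny_major s i then c else switch c" main_color h
    by (rule construction_word[OF s q h(1)])
  let ?n = "real (s ^ (5 * s + 1))"
  have N: "s * (q * large_length s) = 2 * q * s ^ (5 * s + 1)"
    by (simp add: large_length_def)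
  have "real (max_proper_size R L) \<le> (minority + 13 / s) * real (s * (q * large_length s)) +
    24 * real (q * s ^ (4 * s)) * real ((s + 1) * (2 * s + 1)) + 2 * real (q * large_length s) + 2 * real r"
  proof (rule max_proper_size_le)
    show "length L = s * (q * large_length s) + r" by (simp only: L(1) N)
    show "R c d \<longleftrightarrow> d = h c" for c d by (rule h)
    fix k assume k: "k < s * (q * large_length s)"
    have "k div (q * large_length s) < s" using k by (rule less_mult_imp_div_less)
    moreover have "k div q < s * large_length s"
      using k by (intro less_mult_imp_div_less) (simp add: ac_simps)
    ultimately show "L ! k = (let i = (k div (q * large_length s)) mod s; c = main_color (k div (q * small_length s i)) in
       if k mod (q * tiny_length s i) < q * tiny_major s i then c else switch c)"
      using k q by (simp add: L(2) N nth_construction construction_color_def Let_def mod_mult_less_iff div_mult2_eq)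
  qed
  moreover have "(minority + 13 / s) * real (s * (q * large_length s)) = (2 - sqrt 2 + 26 / s) * (real q * ?n)"
  proof -
    have "2 * minority = 2 - sqrt 2" by (simp add: minority_def real_div_sqrt)
    then have "(minority + 13 / s) * (2 * x) = (2 - sqrt 2 + 26 / s) * x" for x
      by (simp add: algebra_simps) (metis distrib_right mult.assoc mult.commute mult_2)
    from this[of "real q * ?n"] show ?thesis unfolding N by (simp add: mult.assoc)
  qed
  moreover have "24 * real (q * s ^ (4 * s)) * real ((s + 1) * (2 * s + 1)) \<le> 144 / s * (real q * ?n)"
  proof -
    \<comment> \<open>The number of cuts is at most 6 s^2 \<le> 6 s^s, which turns
      \<open>s ^ (4 * s)\<close> into \<open>s ^ (5 * s)\<close>, that is n / s.\<close>
    have "(s + 1) * (2 * s + 1) \<le> (2 * s) * (3 * s)" using s by (intro mult_le_mono) auto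
    also have "\<dots> = 6 * s ^ 2" by (simp add: power2_eq_square)
    also have "s ^ 2 \<le> s ^ s" using s by (intro power_increasing) auto
    finally have "s ^ (4 * s) * ((s + 1) * (2 * s + 1)) \<le> s ^ (4 * s) * (6 * s ^ s)"
      by (intro mult_le_mono2) simp
    also have "\<dots> = 6 * s ^ (5 * s)" by (simp flip: power_add)
    finally have "real (s ^ (4 * s)) * real ((s + 1) * (2 * s + 1)) \<le> 6 * real (s ^ (5 * s))"
      unfolding of_nat_mult[symmetric] by linarith
    then have "24 * real q * (real (s ^ (4 * s)) * real ((s + 1) * (2 * s + 1))) \<le> 24 * real q * (6 * real (s ^ (5 * s)))"
      by (intro mult_left_mono) auto
    also have "\<dots> = 144 / s * (real q * ?n)" using s by simp
    finally show ?thesis by (simp only: of_nat_mult mult.assoc)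
  qed
  moreover have "2 * real (q * large_length s) = 4 / s * (real q * ?n)"
    using s by (simp add: large_length_def)
  moreover have "(2 - sqrt 2 + 174 / s) * x = (2 - sqrt 2 + 26 / s) * x + 144 / s * x + 4 / s * x" for x
    by (simp add: algebra_simps add_divide_distrib)
  ultimately show ?thesis
    by (simp only:)
qed

subsection \<open>Color changes\<close>

text \<open>If the bead before the first bead of a maximal arc had the same color, the arc could be
  extended by it.\<close>

lemma mono_arc_extend:
  assumes "mono_arc L A" "\<And>B. mono_arc L B \<Longrightarrow> A \<subseteq> B \<Longrightarrow> A = B" "A \<noteq> {..<length L}"
  obtains p m where "p < length L" "m \<le> length L" "A = (\<lambda>k. (p + k) mod length L) ` {..<m}"
    "L ! p \<noteq> L ! ((p + length L - 1) mod length L)"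
proof -
  define N where "N = length L"
  obtain p0 m where A: "m \<le> N" "A = (\<lambda>k. (p0 + k) mod N) ` {..<m}"
    using assms(1) unfolding mono_arc_def is_arc_def N_def by blast
  obtain c where c: "\<And>x. x \<in> A \<Longrightarrow> L ! x = c"
    using assms(1) unfolding mono_arc_def by blast
  have "A \<noteq> {}" using assms(1) unfolding mono_arc_def by blast
  have "0 < m" using A(2) \<open>A \<noteq> {}\<close> by (cases m) auto
  with A(1) have N: "0 < N" by simp
  define p where "p = p0 mod N"
  have p: "p < N" using N by (simp add: p_def)
  have A': "A = (\<lambda>k. (p + k) mod N) ` {..<m}"
    unfolding A(2) p_def by (simp add: mod_add_left_eq)
  have "A \<subseteq> {..<N}" unfolding A' using N by auto
  have "m < N"
  proof (rule ccontr)
    assume "\<not> m < N"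
    with A(1) have "m = N" by simp
    have "inj_on (\<lambda>k. (p + k) mod N) {..<N}"
      using p by (auto simp: inj_on_def mod_if split: if_splits)
    then have "card A = N" unfolding A' \<open>m = N\<close> by (simp add: card_image)
    with \<open>A \<subseteq> {..<N}\<close> have "A = {..<N}" by (intro card_subset_eq) auto
    with assms(3) show False by (simp add: N_def)
  qed
  define p1 where "p1 = (p + N - 1) mod N"
  have p1: "p1 < N" using N by (simp add: p1_def)
  have step: "(p1 + Suc k) mod N = (p + k) mod N" for k
  proof -
    have "(p1 + Suc k) mod N = (p + N - 1 + Suc k) mod N"
      unfolding p1_def by (rule mod_add_left_eq)
    also have "p + N - 1 + Suc k = (p + k) + N" using N by simp
    finally show ?thesis by simp
  qed
  have "L ! p \<noteq> L ! p1"
  proof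
    assume eq: "L ! p = L ! p1"
    define B where "B = (\<lambda>k. (p1 + k) mod N) ` {..<Suc m}"
    have "p \<in> A" unfolding A' using \<open>0 < m\<close> p by (intro image_eqI[of _ _ 0]) auto
    have B: "B = insert p1 A"
      unfolding B_def A' lessThan_Suc_eq_insert_0 image_insert image_image step
      using p1 by simp
    have "is_arc N B" unfolding is_arc_def B_def using \<open>m < N\<close> by (intro exI[of _ p1] exI[of _ "Suc m"]) auto
    moreover have "\<forall>x\<in>B. L ! x = c" using B c \<open>p \<in> A\<close> eq by auto
    ultimately have "mono_arc L B" using B by (auto simp: mono_arc_def N_def)
    \<comment> \<open>Maximality puts \<open>p1\<close> into \<open>A\<close>, but from
      \<open>p\<close> it is reached only after \<open>N - 1\<close> steps, and \<open>A\<close>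
      takes fewer.\<close>
    then have "A = B" using assms(2) B by blast
    then have "p1 \<in> A" using B by blast
    then obtain k where k: "k < m" "p1 = (p + k) mod N" by (auto simp: A')
    show False
    proof (cases "p = 0")
      case True
      then show False using k \<open>m < N\<close> N by (simp add: p1_def)
    next
      case False
      have eq: "p + N - 1 = (p - 1) + N" using False by simp
      have "p1 = p - 1" unfolding p1_def eq using p by simp
      moreover have "(p + k) mod N = (if p + k < N then p + k else p + k - N)"
        using p k(1) \<open>m < N\<close> by (auto simp: le_mod_geq)
      ultimately show False
        using k \<open>m < N\<close> p False by (simp split: if_splits)
    qed
  qed
  then show ?thesis using p A(1) A' by (intro that[of p m]) (simp_all add: p1_def N_def)
qed

text \<open>Two maximal arcs with the same start are comparable, hence equal, so it suffices to
  count starts. The 2 covers the whole necklace and a start at position 0.\<close>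

lemma mono_count_le:
  "mono_count L \<le> 2 + card {p. 0 < p \<and> p < length L \<and> L ! p \<noteq> L ! (p - 1)}"
proof -
  let ?N = "length L"
  define S where "S = {A. mono_arc L A \<and> (\<forall>B. mono_arc L B \<longrightarrow> A \<subseteq> B \<longrightarrow> A = B)}"
  define C where "C = {p. 0 < p \<and> p < ?N \<and> L ! p \<noteq> L ! (p - 1)}"
  have finC: "finite C" by (rule finite_subset[of _ "{..<?N}"]) (auto simp: C_def)
  have "\<forall>A\<in>S - {{..<?N}}. \<exists>p m. p \<in> insert 0 C \<and> m \<le> ?N \<and> A = (\<lambda>k. (p + k) mod ?N) ` {..<m}"
  proof
    fix A assume A: "A \<in> S - {{..<?N}}"
    obtain p m where p: "p < ?N" "m \<le> ?N" "A = (\<lambda>k. (p + k) mod ?N) ` {..<m}"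
      "L ! p \<noteq> L ! ((p + ?N - 1) mod ?N)"
      using mono_arc_extend[of L A] A by (auto simp: S_def)
    have "p \<in> insert 0 C"
    proof (cases "p = 0")
      case False
      then have eq: "p + ?N - 1 = (p - 1) + ?N" by simp
      have "(p + ?N - 1) mod ?N = p - 1" unfolding eq using p(1) by simp
      with p(4) have "L ! p \<noteq> L ! (p - 1)" by simp
      with p(1) False show ?thesis by (simp add: C_def)
    qed simp
    with p show "\<exists>p m. p \<in> insert 0 C \<and> m \<le> ?N \<and> A = (\<lambda>k. (p + k) mod ?N) ` {..<m}" by blast
  qed
  then obtain st sz where st: "\<And>A. A \<in> S - {{..<?N}} \<Longrightarrow>
      st A \<in> insert 0 C \<and> sz A \<le> ?N \<and> A = (\<lambda>k. (st A + k) mod ?N) ` {..<sz A}"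
    by metis
  have sub: "A \<subseteq> B" if "A \<in> S - {{..<?N}}" "B \<in> S - {{..<?N}}" "st A = st B" "sz A \<le> sz B" for A B
  proof -
    have "A = (\<lambda>k. (st A + k) mod ?N) ` {..<sz A}" using st[OF that(1)] by blast
    also have "\<dots> \<subseteq> (\<lambda>k. (st B + k) mod ?N) ` {..<sz B}"
      unfolding that(3) using that(4) by (intro image_mono) auto
    also have "\<dots> = B" using st[OF that(2)] by blast
    finally show ?thesis .
  qed
  have "inj_on st (S - {{..<?N}})"
  proof (rule inj_onI)
    fix A B assume AB: "A \<in> S - {{..<?N}}" "B \<in> S - {{..<?N}}" "st A = st B"
    then have "A \<subseteq> B \<or> B \<subseteq> A" using sub[of A B] sub[of B A] by (metis nat_le_linear)
    with AB show "A = B" by (auto simp: S_def)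
  qed
  then have "card (S - {{..<?N}}) \<le> card (insert 0 C)"
  proof (rule card_inj_on_le)
    show "st ` (S - {{..<?N}}) \<subseteq> insert 0 C"
      by (rule image_subsetI) (rule conjunct1[OF st])
  qed (use finC in simp)
  also have "\<dots> \<le> Suc (card C)" by (rule card_insert_le_m1) auto
  finally have "card S \<le> 2 + card C"
    using diff_card_le_card_Diff[of "{{..<?N}}" S] by simp
  then show ?thesis by (simp add: mono_count_def S_def C_def)
qed

text \<open>Colors change only where a tiny interval begins or switches its color. Each of the
  \<open>s\<close> large arcs has at most \<open>2 * s ^ (4 * s)\<close> tiny intervals, with two
  such places each.\<close>

lemma mono_count_construction:
  assumes "2 \<le> s"
  shows "real (mono_count (construction minority s)) \<le> 6 / s * real (s ^ (5 * s + 1))"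
proof -
  let ?L = "construction minority s" and ?M = "large_length s"
  define g where "g = (\<lambda>(i, u, b::bool). i * ?M + (u * tiny_length s i + (if b then 0 else tiny_major s i)))"
  define C where "C = {p. 0 < p \<and> p < length ?L \<and> ?L ! p \<noteq> ?L ! (p - 1)}"
  have M: "0 < ?M" using assms by (simp add: large_length_def)
  have "C \<subseteq> g ` ({..<s} \<times> {..<2 * s ^ (4 * s)} \<times> UNIV)"
  proof
    fix p assume p: "p \<in> C"
    define i where "i = p div ?M"
    have pN: "0 < p" "p < s * ?M" "?L ! p \<noteq> ?L ! (p - 1)"
      using p by (auto simp: C_def length_construction)
    have i: "i < s" unfolding i_def using pN by (intro less_mult_imp_div_less) auto
    let ?w = "tiny_length s i" and ?l = "small_length s i"
    have w: "0 < ?w" "0 < ?l" using assms by (auto simp: tiny_length_def small_length_def)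
    have Mw: "?M = ?w * (2 * s ^ (3 * s + Suc i))"
      unfolding large_length_def tiny_length_def mult.left_commute[of _ 2] power_add[symmetric]
      using i by (intro arg_cong[where f = "(*) 2"] arg_cong[where f = "power s"]) simp
    have wl: "?w dvd ?l" by (simp add: small_length_eq[OF i])
    have lM: "?w dvd ?M" using Mw by simp
    have "p mod ?w = 0 \<or> p mod ?w = tiny_major s i"
    proof (rule ccontr)
      assume *: "\<not> (p mod ?w = 0 \<or> p mod ?w = tiny_major s i)"
      \<comment> \<open>\<open>p\<close> is not a multiple of the tiny length, hence not of
        \<open>d\<close>, so \<open>p - 1\<close> and \<open>p\<close> lie in the same block of
        length \<open>d\<close>.\<close>
      have dec: "(p - 1) div d = p div d" if "?w dvd d" "0 < d" for d
      proof -
        have "p mod d \<noteq> 0" using * that(1) by (metis dvd_trans mod_0_imp_dvd dvd_imp_mod_0)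
        then have "p - 1 = p div d * d + (p mod d - 1)"
          using div_mult_mod_eq[of p d] by linarith
        moreover have "p mod d - 1 < d" using that(2) mod_less_divisor[of d p] by linarith
        ultimately show ?thesis by simp
      qed
      have "(p - 1) mod ?w = p mod ?w - 1"
      proof -
        have "p - 1 = p div ?w * ?w + (p mod ?w - 1)"
          using * div_mult_mod_eq[of p ?w] by linarith
        moreover have "p mod ?w - 1 < ?w" using w(1) mod_less_divisor[of ?w p] by linarith
        ultimately show ?thesis by simp
      qed
      with * have "(p - 1) mod ?w < tiny_major s i \<longleftrightarrow> p mod ?w < tiny_major s i" by auto
      moreover have "(p - 1) div ?M = i" using dec[OF lM M] by (simp add: i_def)
      moreover have "(p - 1) div ?l = p div ?l" using dec[OF wl w(2)] .
      ultimately have "construction_color s (p - 1) = construction_color s p"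
        by (simp add: construction_color_def Let_def i_def[symmetric])
      with pN show False by (simp add: nth_construction)
    qed
    moreover have "p = i * ?M + p mod ?M" by (simp add: i_def)
    moreover have "p mod ?M = (p mod ?M) div ?w * ?w + p mod ?w"
      using lM by (metis div_mult_mod_eq mod_mod_cancel)
    moreover have "(p mod ?M) div ?w < 2 * s ^ (4 * s)"
    proof -
      have "p mod ?M < (2 * s ^ (3 * s + Suc i)) * ?w" using M Mw by (metis mod_less_divisor mult.commute)
      then have "(p mod ?M) div ?w < 2 * s ^ (3 * s + Suc i)" by (rule less_mult_imp_div_less)
      also have "\<dots> \<le> 2 * s ^ (4 * s)" using i assms by (intro mult_le_mono2 power_increasing) auto
      finally show ?thesis .
    qed
    ultimately show "p \<in> g ` ({..<s} \<times> {..<2 * s ^ (4 * s)} \<times> UNIV)"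
      using i by (intro image_eqI[of _ _ "(i, (p mod ?M) div ?w, p mod ?w = 0)"]) (auto simp: g_def)
  qed
  then have "card C \<le> card ({..<s} \<times> {..<2 * s ^ (4 * s)} \<times> (UNIV :: bool set))"
    by (rule surj_card_le[rotated]) simp
  also have "\<dots> = 4 * (s * s ^ (4 * s))" by (simp add: card_cartesian_product)
  finally have "mono_count ?L \<le> 2 + 4 * (s * s ^ (4 * s))"
    using mono_count_le[of ?L] by (simp add: C_def)
  also have "\<dots> \<le> 6 * (s * s ^ (4 * s))"
    using assms by simp
  also have "s * s ^ (4 * s) = s ^ (4 * s + 1)" by simp
  also have "\<dots> \<le> s ^ (5 * s)" using assms by (intro power_increasing) auto
  finally have "real (mono_count ?L) \<le> real (6 * s ^ (5 * s))" by (simp only: of_nat_le_iff)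
  also have "\<dots> = 6 / s * real (s ^ (5 * s + 1))" using assms by simp
  finally show ?thesis .
qed

subsection \<open>Balance and the upper limit\<close>

lemma count_switch:
  "count_list (tiny_interval lam s i (switch c)) d = count_list (tiny_interval lam s i c) (switch d)"
proof -
  have "count_list (replicate k x) y = (if x = y then k else 0)" for k and x y :: color
    by (induction k) auto
  then show ?thesis by (cases c; cases d) (simp_all add: tiny_interval_def Let_def)
qed

lemma count_list_concat: "count_list (concat xss) x = (\<Sum>xs\<leftarrow>xss. count_list xs x)"
  by (induction xss) auto

lemma count_small_arc:
  "count_list (small_arc lam s i (Suc j)) d = count_list (small_arc lam s i j) (switch d)"
proof -
  have "(if odd (Suc j) then Red else Blue) = switch (if odd j then Red else Blue)" by simp
  then show ?thesis
    unfolding small_arc_def count_list_concat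
    by (simp only: count_switch map_replicate)
qed

text \<open>Consecutive small arcs have their color counts interchanged, and their number is
  even.\<close>

lemma count_large_arc: "count_list (large_arc lam s i) Red = count_list (large_arc lam s i) Blue"
proof -
  have "count_list (concat (map (small_arc lam s i) [1..<2 * K + 1])) Red =
      count_list (concat (map (small_arc lam s i) [1..<2 * K + 1])) Blue" for K
  proof (induction K)
    case (Suc K)
    have "count_list (small_arc lam s i (Suc (2 * K + 1))) Red = count_list (small_arc lam s i (2 * K + 1)) Blue"
      "count_list (small_arc lam s i (Suc (2 * K + 1))) Blue = count_list (small_arc lam s i (2 * K + 1)) Red"
      using count_small_arc[of lam s i "2 * K + 1"] by simp_all
    moreover have "[1..<2 * Suc K + 1] = [1..<2 * K + 1] @ [2 * K + 1, Suc (2 * K + 1)]" by simp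
    ultimately show ?case using Suc by simp
  qed simp
  then show ?thesis unfolding large_arc_def .
qed

lemma balanced_iff:
  "L \<in> balanced_necklaces N \<longleftrightarrow> length L = N \<and> count_list L Red = count_list L Blue"
proof -
  have "count_list L Red + count_list L Blue = length L"
  proof (induction L)
    case (Cons c L)
    then show ?case by (cases c) auto
  qed simp
  then show ?thesis by (auto simp: balanced_necklaces_def)
qed

lemma construction_balanced:
  "construction minority s \<in> balanced_necklaces (2 * s ^ (5 * s + 1))"
proof -
  have "count_list (construction minority s) Red = count_list (construction minority s) Blue"
    unfolding construction_def count_list_concat map_map comp_def count_large_arc ..
  then show ?thesis
    by (simp add: balanced_iff length_construction large_length_def)
qed

section \<open>Blow-ups of necklaces and bounds on \<open>mu_at\<close>\<close>

definition blowup :: "nat \<Rightarrow> necklace \<Rightarrow> necklace" where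
  "blowup q L = concat (map (replicate q) L)"

lemma length_blowup: "length (blowup q L) = q * length L"
  unfolding blowup_def by (induction L) auto

lemma count_blowup: "count_list (blowup q L) c = q * count_list L c"
proof -
  have "count_list (replicate q x) y = (if x = y then q else 0)" for x y :: color
    by (induction q) auto
  then show ?thesis unfolding blowup_def by (induction L) auto
qed

lemma nth_blowup:
  assumes "0 < q" "k < q * length L"
  shows "blowup q L ! k = L ! (k div q)"
proof -
  have "map (replicate q) L = map (\<lambda>i. replicate q (L ! i)) [0..<length L]"
    by (metis (no_types, lifting) map_nth map_map comp_def map_cong)
  then show ?thesis
    unfolding blowup_def using assms
    by (subst \<open>map (replicate q) L = _\<close>, subst nth_concat_blocks[where d = q]) (auto simp: mult.commute)
qed

lemma mu_at_le:
  assumes "L \<in> balanced_necklaces N"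
  shows "mu_at R N \<le> 2 * max_proper_size R L"
proof -
  have "finite (balanced_necklaces N)"
  proof (rule finite_subset)
    have "(UNIV :: color set) = {Red, Blue}" using color.exhaust by blast
    then have "finite (UNIV :: color set)" by (metis finite.emptyI finite.insertI)
    then show "finite {L :: necklace. set L \<subseteq> UNIV \<and> length L = N}" by (rule finite_lists_length_eq)
  qed (auto simp: balanced_necklaces_def)
  then have "mu_at R N \<le> (MAX M\<in>proper_matchings R L. 2 * card M)"
    unfolding mu_at_def using assms by (intro Min_le) auto
  also have "\<dots> \<le> 2 * max_proper_size R L"
    unfolding max_proper_size_def using finite_proper_matchings[of R L] empty_in_proper_matchings[of R L]
    by (subst Max_le_iff) (auto intro!: Max_ge)
  finally show ?thesis .
qed

text \<open>Arbitrary even lengths are reached by replacing every bead by \<open>q\<close> equal beads and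
  appending fewer than \<open>2 n\<close> further beads.\<close>

lemma mu_at_ratio_le:
  assumes s: "2 \<le> s" and h: "\<And>c. h (h c) = c" "\<And>c d. R c d \<longleftrightarrow> d = h c"
    and k: "4 * s * s ^ (5 * s + 1) \<le> k"
  shows "real (mu_at R (2 * k)) / real (2 * k) \<le> 2 - sqrt 2 + 175 / s"
proof -
  define n where "n = s ^ (5 * s + 1)"
  \<comment> \<open>The \<open>q\<close>-fold blow-up has 2 q n beads; \<open>t\<close> red and
    \<open>t\<close> blue beads complete it to length \<open>2 * k\<close>.\<close>
  define q where "q = k div n"
  define t where "t = k mod n"
  have n: "0 < n" using s by (simp add: n_def)
  have kn: "4 * s * n \<le> k" using k by (simp add: n_def)
  have "1 * n \<le> 4 * s * n" using s by (intro mult_le_mono1) simp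
  with kn have nk: "n \<le> k" by linarith
  have q: "0 < q" using nk n by (simp add: q_def div_greater_zero_iff)
  have kq: "k = q * n + t" by (simp add: q_def t_def)
  have t: "t < n" using n by (simp add: t_def)
  let ?C = "construction minority s"
  define L where "L = blowup q ?C @ replicate t Red @ replicate t Blue"
  have C: "length ?C = 2 * n" "count_list ?C Red = count_list ?C Blue"
    using construction_balanced[of s] by (auto simp: balanced_iff n_def)
  have cr: "count_list (replicate t x) y = (if x = y then t else 0)" for x y :: color
    by (induction t) auto
  have len: "length L = 2 * q * n + 2 * t"
    by (simp add: L_def length_blowup C)
  have "L \<in> balanced_necklaces (2 * k)"
    using len C(2) by (simp add: balanced_iff kq) (simp add: L_def count_blowup cr)
  then have "real (mu_at R (2 * k)) \<le> 2 * real (max_proper_size R L)"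
    using mu_at_le[of L "2 * k" R] by linarith
  also have "real (max_proper_size R L) \<le> (2 - sqrt 2 + 174 / s) * (real q * real n) + 2 * real (2 * t)"
    unfolding n_def
  proof (rule max_proper_size_blowup[OF s q h])
    show "length L = 2 * q * s ^ (5 * s + 1) + 2 * t" using len by (simp add: n_def)
    fix j assume "j < 2 * q * s ^ (5 * s + 1)"
    then have "j < q * length ?C" unfolding C(1) by (simp add: n_def ac_simps)
    then show "L ! j = ?C ! (j div q)"
      using nth_blowup[OF q] by (simp add: L_def nth_append length_blowup)
  qed
  also have "(2 - sqrt 2 + 174 / s) * (real q * real n) \<le> (2 - sqrt 2 + 174 / s) * real k"
  proof (rule mult_left_mono)
    show "real q * real n \<le> real k" by (simp add: kq)
    have "sqrt 2 \<le> 2" using real_sqrt_le_mono[of 2 4] by simp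
    then show "0 \<le> 2 - sqrt 2 + 174 / s" by simp
  qed
  \<comment> \<open>Here the threshold on \<open>k\<close> enters: \<open>t < n\<close> and
    \<open>4 * s * n \<le> k\<close> make the appended beads cost at most k / s, which raises 174 to
    175.\<close>
  also have "2 * real (2 * t) \<le> 1 / s * real k"
  proof -
    have "4 * s * t \<le> 4 * s * n" using t by (intro mult_le_mono2) simp
    with kn have "4 * s * t \<le> k" by linarith
    then have "real (4 * s * t) \<le> real k" by (simp only: of_nat_le_iff)
    then show ?thesis using s by (simp add: field_simps)
  qed
  finally have "real (mu_at R (2 * k)) \<le> (2 - sqrt 2 + 175 / s) * real (2 * k)"
    by (simp add: algebra_simps add_divide_distrib)
  moreover have "0 < real (2 * k)" using nk n by simp
  ultimately show ?thesis by (simp add: divide_le_eq)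
qed

text \<open>For fixed \<open>s\<close> the ratio bound holds for all large \<open>k\<close> and so
  passes to the upper limit; afterwards \<open>s\<close> tends to infinity.\<close>

lemma mu_le:
  assumes h: "\<And>c. h (h c) = c" "\<And>c d. R c d \<longleftrightarrow> d = h c"
  shows "mu R \<le> ereal (2 - sqrt 2)"
proof -
  have bound: "mu R \<le> ereal (2 - sqrt 2 + 175 / real s)" if "2 \<le> s" for s
    unfolding mu_def
  proof (rule Limsup_bounded)
    show "\<forall>\<^sub>F k in sequentially. ereal (real (mu_at R (2 * k)) / real (2 * k)) \<le> ereal (2 - sqrt 2 + 175 / real s)"
      using eventually_ge_at_top[of "4 * s * s ^ (5 * s + 1)"]
      by eventually_elim (use mu_at_ratio_le[OF that h] in simp)
  qed
  have "(\<lambda>s. 2 - sqrt 2 + 175 / real s) \<longlonglongrightarrow> 2 - sqrt 2 + 0"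
    by (intro tendsto_intros lim_const_over_n)
  then have "(\<lambda>s. ereal (2 - sqrt 2 + 175 / real s)) \<longlonglongrightarrow> ereal (2 - sqrt 2)"
    by (simp add: tendsto_ereal)
  then show ?thesis
    by (rule LIMSEQ_le_const) (use bound in blast)
qed

section \<open>Asymptotic form of the bounds\<close>

lemma over_s_smallo: "(\<lambda>s. c / real s * real (m s)) \<in> o(\<lambda>s. real (m s))"
proof -
  have "(\<lambda>s::nat. c / real s) \<in> o(\<lambda>_. 1 :: real)"
    by (intro smalloI_tendsto) (use lim_const_over_n[of c] in simp_all)
  then have "(\<lambda>s. c / real s * real (m s)) \<in> o(\<lambda>s. 1 * real (m s))"
    by (rule landau_o.small_big_mult) simp
  then show ?thesis by simp
qed

lemma max_proper_size_construction:
  assumes "2 \<le> s" and h: "\<And>c. h (h c) = c" "\<And>c d. R c d \<longleftrightarrow> d = h c"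
  shows "real (max_proper_size R (construction minority s)) \<le>
    (2 - sqrt 2) * real (s ^ (5 * s + 1)) + 174 / s * real (s ^ (5 * s + 1))"
proof -
  have "length (construction minority s) = 2 * 1 * s ^ (5 * s + 1) + 0"
    using construction_balanced[of s] by (simp add: balanced_iff)
  from max_proper_size_blowup[OF assms(1) _ h this] show ?thesis
    by (simp add: distrib_right)
qed

theorem theorem3:
  fixes L :: "nat \<Rightarrow> necklace" and n :: "nat \<Rightarrow> nat"
  assumes "\<And>s. n s = s ^ (5 * s + 1)"
    and "\<And>s. L s = construction (1 - 1 / sqrt 2) s"
  shows "(\<forall>s\<ge>2. L s \<in> balanced_necklaces (2 * n s)) \<and>
    (\<exists>f. f \<in> o(\<lambda>s. real (n s)) \<and>
      (\<forall>s\<ge>2. real (max_proper_size het (L s)) \<le> (2 - sqrt 2) * real (n s) + f s)) \<and>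
    (\<exists>f. f \<in> o(\<lambda>s. real (n s)) \<and>
      (\<forall>s\<ge>2. real (max_proper_size homog (L s)) \<le> (2 - sqrt 2) * real (n s) + f s)) \<and>
    mu het \<le> ereal (2 - sqrt 2) \<and>
    mu homog \<le> ereal (2 - sqrt 2) \<and>
    (\<lambda>s. real (mono_count (L s))) \<in> o(\<lambda>s. real (n s))"
proof -
  have L: "L s = construction minority s" for s
    by (simp add: assms(2) minority_def)
  \<comment> \<open>Both models are instances of one argument, the partner colors being given by an
    involution: \<open>switch\<close> in the heterogeneous and \<open>id\<close> in the homogeneous
    model.\<close>
  have het: "het c d \<longleftrightarrow> d = switch c" for c d
    by (cases c; cases d) (simp_all add: het_def)
  have homog: "homog c d \<longleftrightarrow> d = id c" for c d
    by (auto simp: homog_def)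
  have size: "\<exists>f. f \<in> o(\<lambda>s. real (n s)) \<and>
      (\<forall>s\<ge>2. real (max_proper_size R (L s)) \<le> (2 - sqrt 2) * real (n s) + f s)"
    if "\<And>c. h (h c) = c" "\<And>c d. R c d \<longleftrightarrow> d = h c" for R h
    using max_proper_size_construction[OF _ that] over_s_smallo[of 174 n]
    unfolding L assms(1) by blast
  have "(\<lambda>s. real (mono_count (L s))) \<in> O(\<lambda>s. 6 / real s * real (n s))"
  proof (rule landau_o.big_mono)
    show "\<forall>\<^sub>F s in sequentially. norm (real (mono_count (L s))) \<le> norm (6 / real s * real (n s))"
      using eventually_ge_at_top[of 2]
      by eventually_elim (use mono_count_construction in \<open>simp add: L assms(1)\<close>)
  qed
  then have "(\<lambda>s. real (mono_count (L s))) \<in> o(\<lambda>s. real (n s))"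
    using over_s_smallo by (rule landau_o.big_small_trans)
  moreover have "\<forall>s\<ge>2. L s \<in> balanced_necklaces (2 * n s)"
    by (simp only: L assms(1) construction_balanced) simp
  ultimately show ?thesis
    using size[of switch het, OF switch_switch het] size[of id homog, OF _ homog]
      mu_le[of switch het, OF switch_switch het] mu_le[of id homog, OF _ homog]
    by simp
qed

end
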